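(* Let $\omega\in\mathbb{R}^d$ have positive components and let $\beta\in\mathfrak{g}$ be arbitrary. Consider the (formal) autonomous system $$\frac{d}{dt}x=\frac{d}{dt}\begin{bmatrix}y\\ \theta\end{bmatrix}=\begin{bmatrix}0\\ \omega\end{bmatrix}+W_\beta(x)=\overline{W}_{(\omega,\beta)}(x).\qquad(\mathrm{S})$$ There is a change of variables $x=W_\kappa(X)$, $\kappa\in\mathcal{G}$, that reduces (S) to the form $$\frac{d}{dt}X=\frac{d}{dt}\begin{bmatrix}Y\\ \Theta\end{bmatrix}=\begin{bmatrix}0\\ \omega\end{bmatrix}+W_{\widehat\beta}(X)=\overline{W}_{(\omega,\widehat\beta)}(X),\qquad(\mathrm{T})$$ (that is, $\xi_\omega\kappa+\widehat\beta\star\kappa=\kappa\star\beta$), where $\widehat\beta\in\mathfrak{g}$ and $\widehat\beta_w=0$ for all words $w=\mathbf{k}_1\cdots\mathbf{k}_n$ such that $(\mathbf{k}_1+\cdots+\mathbf{k}_n)\cdot\omega\neq 0$. Furthermore, the vector fields $\overline{W}_{(\omega,0)}(X)$ and $\overline{W}_{(0,\widehat\beta)}(X)$ commute, and the solutions of (T) satisfy $$X(t)=\phi_t\Big(X(0)+\begin{bmatrix}0\\ t\omega\end{bmatrix}\Big)=\phi_t(X(0))+\begin{bmatrix}0\\ t\omega\end{bmatrix},$$ where $\phi_t$ is the solution flow of the system $\frac{d}{dt}X=W_{\widehat\beta}(X)$. Equivalently, $X(t)=\overline{W}_{(t\omega,\widehat\alpha(t))}(X(0))$, where $$(t\omega,\widehat\alpha(t))=(t\omega,\exp_\star(t\widehat\beta))=\exp_\star(t\widehat\beta)\,\bigstar\,(t\omega,\mathbf{1})=(t\omega,\mathbf{1})\,\bigstar\,\exp_\star(t\widehat\beta).$$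 If the system (S) is Hamiltonian, the change of variables is canonical symplectic and the transformed system (T) is Hamiltonian.
   Context: **Setting.** Let $0<d\le D$ be integers and $x=(y,\theta)$ with $y\in\mathbb{R}^{D-d}$ and $\theta\in\mathbb{R}^d$ a vector of angles. Let $\omega\in\mathbb{R}^d$ have components $\omega_j>0$. Let $f(y,\theta)=\sum_{\mathbf{k}\in\mathbb{Z}^d}f_{\mathbf{k}}(y,\theta)$ be smooth, $\mathbb{R}^D$-valued and $2\pi$-periodic in each component of $\theta$, with $f_{\mathbf{k}}(y,\theta)=\exp(i\mathbf{k}\cdot\theta)\hat f_{\mathbf{k}}(y)$, where the $\hat f_{\mathbf{k}}$ are $\mathbb{C}^D$-valued Fourier coefficients ($\hat f_{-\mathbf{k}}$ is the complex conjugate of $\hat f_{\mathbf{k}}$). **Words.** $\mathcal{W}$ is the set of words $\mathbf{k}_1\cdots\mathbf{k}_n$, $n\ge 0$, over the alphabet $\mathbb{Z}^d$; $\mathcal{W}_n$ is the set of words with $n$ letters; $\emptyset$ is the empty word. $\mathbb{C}^{\mathcal{W}}$ is the vector space of maps $\delta:\mathcal{W}\to\mathbb{C}$, $w\mapsto\delta_w$. The word-basis functions are $f_\emptyset(x)=x$, $f_{\mathbf{k}}(x)=f_{\mathbf{k}}(y,\theta)=\exp(i\mathbf{k}\cdot\theta)\hat f_{\mathbf{k}}(y)$ for one letter, and $f_{\mathbf{k}_1\cdots\mathbf{k}_n}(x)=\big(\partial_xf_{\mathbf{k}_2\cdots\mathbf{k}_n}(x)\big)f_{\mathbf{k}_1}(x)$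 for $n>1$ ($\partial_x$ is the Jacobian with respect to $x=(y,\theta)$). **Series.** For $\delta\in\mathbb{C}^{\mathcal{W}}$ the word series is the formal series $W_\delta(x)=\sum_{w\in\mathcal{W}}\delta_wf_w(x)$. For $(v,\delta)\in\mathbb{C}^d\oplus\mathbb{C}^{\mathcal{W}}$ the extended word series is $\overline{W}_{(v,\delta)}(x)=\begin{bmatrix}0\\ v\end{bmatrix}+W_\delta(x)$. All series, flows and changes of variables are formal: with $\epsilon f_{\mathbf{k}}$ in place of $f_{\mathbf{k}}$ they are formal power series in $\epsilon$, words with $n$ letters contributing to $\epsilon^n$ (the sum over the infinitely many words of $n$ letters is itself formal), and identities are understood at the level of coefficients. **Operations.** Convolution product: $(\delta\star\delta')_{a_1\cdots a_n}=\delta_\emptyset\delta'_{a_1\cdots a_n}+\sum_{j=1}^{n-1}\delta_{a_1\cdots a_j}\delta'_{a_{j+1}\cdots a_n}+\delta_{a_1\cdots a_n}\delta'_\emptyset$, and $(\delta\star\delta')_\emptyset=\delta_\emptyset\delta'_\emptyset$. Its unit is $\mathbf{1}$, with $\mathbf{1}_\emptyset=1$ and $\mathbf{1}_w=0$ for $w\ne\emptyset$. The shuffle product of words of lengths $m,n$ is the formal sum $\sum_{j=1}^Nw_j$ (with multiplicity, $N=(m+n)!/(m!n!)$) of all interleavings of the two words preserving the order of the letters in each; shuffling with $\emptyset$ leaves a word unchanged. $\mathcal{G}$ is the set (a group under $\star$) of $\gamma\in\mathbb{C}^{\mathcal{W}}$ with $\gamma_\emptyset=1$ and $\gamma_w\gamma_{w'}=\sum_j\gamma_{w_j}$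 whenever the shuffle of $w,w'$ is $\sum_jw_j$. $\mathfrak{g}$ is the set of $\beta\in\mathbb{C}^{\mathcal{W}}$ with $\beta_\emptyset=0$ and $\sum_j\beta_{w_j}=0$ whenever $w,w'$ are nonempty words with shuffle $\sum_jw_j$. For $\beta\in\mathfrak{g}$, $\exp_\star(t\beta)=\mathbf{1}+\sum_{j\ge1}\frac{t^j}{j!}\beta^{\star j}\in\mathcal{G}$. For $v\in\mathbb{C}^d$, the linear operators $\Xi_v,\xi_v$ on $\mathbb{C}^{\mathcal{W}}$ are $(\Xi_v\delta)_\emptyset=\delta_\emptyset$, $(\Xi_v\delta)_{\mathbf{k}_1\cdots\mathbf{k}_n}=\exp(i(\mathbf{k}_1+\cdots+\mathbf{k}_n)\cdot v)\,\delta_{\mathbf{k}_1\cdots\mathbf{k}_n}$, and $(\xi_v\delta)_\emptyset=0$, $(\xi_v\delta)_{\mathbf{k}_1\cdots\mathbf{k}_n}=i(\mathbf{k}_1+\cdots+\mathbf{k}_n)\cdot v\;\delta_{\mathbf{k}_1\cdots\mathbf{k}_n}$. For $u,v\in\mathbb{C}^d$, $\gamma\in\mathcal{G}$, $\delta\in\mathbb{C}^{\mathcal{W}}$: $(u,\gamma)\bigstar(v,\delta)=(\gamma_\emptyset v+\delta_\emptyset u,\ \gamma\star(\Xi_u\delta))$. Elements $\gamma\in\mathcal{G}$ are identified with $(0,\gamma)$. Formal substitution is given by $W_\delta(W_\gamma(x))=W_{\gamma\star\delta}(x)$ and $\overline{W}_{(v,\delta)}(\overline{W}_{(u,\gamma)}(x))=\overline{W}_{(u,\gamma)\bigstar(v,\delta)}(x)$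 for $\gamma\in\mathcal{G}$. **Systems.** The solution of $\frac{d}{dt}X=\overline{W}_{(\omega,B)}(X)$, $B\in\mathfrak{g}$, is $X(t)=\overline{W}_{(t\omega,\alpha(t))}(X(0))$, where $\frac{d}{dt}\alpha=\alpha\star(\Xi_{t\omega}B)$, $\alpha(0)=\mathbf{1}$; the flow of $\frac{d}{dt}X=W_B(X)$ is $W_{\alpha(t)}$ with $\frac{d}{dt}\alpha=\alpha\star B$, $\alpha(0)=\mathbf{1}$. The change of variables $x=W_\kappa(X)$, $\kappa\in\mathcal{G}$, transforms $\frac{d}{dt}x=\overline{W}_{(\omega,\beta)}(x)$ into $\frac{d}{dt}X=\overline{W}_{(\omega,\widehat\beta)}(X)$ with $\xi_\omega\kappa+\widehat\beta\star\kappa=\kappa\star\beta$. The Jacobi bracket of $\overline{W}_{(v,\delta)}$ and $\overline{W}_{(u,\eta)}$ ($\delta,\eta\in\mathfrak{g}$) is $\overline{W}_{(0,\ \xi_v\eta-\xi_u\delta+\delta\star\eta-\eta\star\delta)}$; two (formal) vector fields commute if their bracket vanishes. **Hamiltonian case.** Here $D$ is even, $m=D/2-d\ge0$, $x=(p^1,\dots,p^m;q^1,\dots,q^m;a^1,\dots,a^d;\theta^1,\dots,\theta^d)$ where $p^j$ is the momentum canonically conjugate to $q^j$ and $a^j$ the momentum (action) conjugate to $\theta^j$, and each $f_{\mathbf{k}}$ is a Hamiltonian vector field $J^{-1}\nabla H_{\mathbf{k}}$ with respect to the standard symplectic structure. *)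

theory Defs
  imports "HOL-Analysis.Analysis" "HOL-Library.Multiset"
begin

section \<open>Words and coefficients\<close>

text \<open>
  Letters are elements of \<open>int ^ 'd\<close> and words are lists of letters.  An extended coefficient
  \<open>(v, \<delta>)\<close> stands for the formal field or map \<open>(0, v) + W\<^sub>\<delta>\<close>.
\<close>

type_synonym 'd coeff = "(int ^ 'd) list \<Rightarrow> complex"
type_synonym 'd ext_coeff = "(complex ^ 'd) \<times> 'd coeff"

definition cvec :: "real ^ 'a \<Rightarrow> complex ^ 'a" where
  "cvec x = (\<chi> i. complex_of_real (x $ i))"

definition unit_coeff :: "('d::finite) coeff" where
  "unit_coeff w = (if w = [] then 1 else 0)"

text \<open>
  All deconcatenations of \<open>w\<close> occur exactly once, including the two trivial ones; for the empty
  word they coincide and there is a single summand.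
\<close>

definition conv :: "('d::finite) coeff \<Rightarrow> 'd coeff \<Rightarrow> 'd coeff"  (infixl \<open>\<star>\<close> 70) where
  "(\<delta> \<star> \<delta>') w = (\<Sum>j\<le>length w. \<delta> (take j w) * \<delta>' (drop j w))"

primrec conv_power :: "('d::finite) coeff \<Rightarrow> nat \<Rightarrow> 'd coeff" where
  "conv_power \<beta> 0 = unit_coeff"
| "conv_power \<beta> (Suc n) = \<beta> \<star> conv_power \<beta> n"

text \<open>
  For \<open>\<beta> [] = 0\<close> the \<open>j\<close>-th convolution power vanishes on words of length less than \<open>j\<close>, so the
  series below has only finitely many nonzero terms at each word.
\<close>

definition exp_conv :: "real \<Rightarrow> ('d::finite) coeff \<Rightarrow> 'd coeff" where
  "exp_conv t \<beta> w = (\<Sum>j. complex_of_real (t ^ j / fact j) * conv_power \<beta> j w)"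

text \<open>
  The shuffle product with multiplicities.  The library's \<^const>\<open>shuffles\<close> is only the underlying set.
\<close>

fun shuffle :: "'a list \<Rightarrow> 'a list \<Rightarrow> 'a list list" where
  "shuffle [] ys = [ys]"
| "shuffle (x # xs) [] = [x # xs]"
| "shuffle (x # xs) (y # ys) =
     map ((#) x) (shuffle xs (y # ys)) @ map ((#) y) (shuffle (x # xs) ys)"

lemma set_shuffle: "set (shuffle xs ys) = shuffles xs ys"
  by (induction xs ys rule: shuffle.induct) auto

lemma length_shuffle: "length (shuffle xs ys) = (length xs + length ys) choose length xs"
  by (induction xs ys rule: shuffle.induct) (auto simp: add.commute)

definition grp :: "('d::finite) coeff set" where
  "grp = {\<gamma>. \<gamma> [] = 1 \<and> (\<forall>w w'. \<gamma> w * \<gamma> w' = (\<Sum>u\<leftarrow>shuffle w w'. \<gamma> u))}"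

definition lie :: "('d::finite) coeff set" where
  "lie = {\<beta>. \<beta> [] = 0 \<and>
     (\<forall>w w'. w \<noteq> [] \<longrightarrow> w' \<noteq> [] \<longrightarrow> (\<Sum>u\<leftarrow>shuffle w w'. \<beta> u) = 0)}"

text \<open>\<open>word_dot w v\<close> is \<open>(k\<^sub>1 + \<dots> + k\<^sub>n) \<cdot> v\<close>, bilinear (no conjugation of \<open>v\<close>).\<close>

definition word_dot :: "(int ^ ('d::finite)) list \<Rightarrow> complex ^ 'd \<Rightarrow> complex" where
  "word_dot w v = (\<Sum>j\<in>UNIV. of_int (sum_list w $ j) * v $ j)"

definition Xi :: "complex ^ ('d::finite) \<Rightarrow> 'd coeff \<Rightarrow> 'd coeff" where
  "Xi v \<delta> w = exp (\<i> * word_dot w v) * \<delta> w"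

definition xi :: "complex ^ ('d::finite) \<Rightarrow> 'd coeff \<Rightarrow> 'd coeff" where
  "xi v \<delta> w = \<i> * word_dot w v * \<delta> w"

fun ext_mult :: "('d::finite) ext_coeff \<Rightarrow> 'd ext_coeff \<Rightarrow> 'd ext_coeff"  (infixl \<open>\<^bold>\<star>\<close> 70) where
  "(u, \<gamma>) \<^bold>\<star> (v, \<delta>) = (\<gamma> [] *s v + \<delta> [] *s u, \<gamma> \<star> Xi u \<delta>)"

text \<open>
  Formal substitution: \<open>ext_subst a b\<close> is the coefficient of the map sending \<open>x\<close> to
  \<open>W\<^sub>a (W\<^sub>b x)\<close>; the order of the factors is reversed.
\<close>

definition ext_subst :: "('d::finite) ext_coeff \<Rightarrow> 'd ext_coeff \<Rightarrow> 'd ext_coeff" where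
  "ext_subst a b = b \<^bold>\<star> a"

fun jacobi_bracket :: "('d::finite) ext_coeff \<Rightarrow> 'd ext_coeff \<Rightarrow> 'd ext_coeff" where
  "jacobi_bracket (v, \<delta>) (u, \<eta>) =
     (0, \<lambda>w. xi v \<eta> w - xi u \<delta> w + (\<delta> \<star> \<eta>) w - (\<eta> \<star> \<delta>) w)"

definition commuting :: "('d::finite) ext_coeff \<Rightarrow> 'd ext_coeff \<Rightarrow> bool" where
  "commuting a b \<longleftrightarrow> jacobi_bracket a b = (0, \<lambda>_. 0)"

text \<open>
  \<open>ext_solution \<omega> B \<alpha>\<close>: the solution of \<open>X' = (0, \<omega>) + W\<^sub>B(X)\<close> is \<open>(0, t\<omega>) + W\<^sub>\<alpha>\<^sub>(\<^sub>t\<^sub>)(X(0))\<close>;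
  \<open>word_flow B \<alpha>\<close>: the flow of \<open>X' = W\<^sub>B(X)\<close> is \<open>W\<^sub>\<alpha>\<^sub>(\<^sub>t\<^sub>)\<close>.
\<close>

definition ext_solution :: "complex ^ ('d::finite) \<Rightarrow> 'd coeff \<Rightarrow> (real \<Rightarrow> 'd coeff) \<Rightarrow> bool" where
  "ext_solution \<omega> B \<alpha> \<longleftrightarrow> \<alpha> 0 = unit_coeff \<and>
     (\<forall>t w. ((\<lambda>s. \<alpha> s w) has_vector_derivative (\<alpha> t \<star> Xi (t *\<^sub>R \<omega>) B) w) (at t))"

definition word_flow :: "('d::finite) coeff \<Rightarrow> (real \<Rightarrow> 'd coeff) \<Rightarrow> bool" where
  "word_flow B \<alpha> \<longleftrightarrow> \<alpha> 0 = unit_coeff \<and>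
     (\<forall>t w. ((\<lambda>s. \<alpha> s w) has_vector_derivative (\<alpha> t \<star> B) w) (at t))"

section \<open>The phase space and the Fourier modes\<close>

text \<open>
  The phase space is \<open>real ^ 'n\<close> with \<open>D = CARD('n)\<close> and \<open>d = CARD('d)\<close>.  An injection
  \<open>ang :: 'd \<Rightarrow> 'n\<close> says which coordinates are the angles; the remaining \<open>D - d\<close> coordinates,
  possibly none, form \<open>y\<close>.  A function of \<open>y\<close> alone is a function of \<open>y_part ang x\<close>, the vector
  \<open>x\<close> with its angles replaced by 0.
\<close>

definition y_part :: "('d::finite \<Rightarrow> 'n::finite) \<Rightarrow> real ^ 'n \<Rightarrow> real ^ 'n" where
  "y_part ang x = (\<chi> i. if i \<in> range ang then 0 else x $ i)"

definition angle_part :: "('d::finite \<Rightarrow> 'n::finite) \<Rightarrow> real ^ 'n \<Rightarrow> real ^ 'd" where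
  "angle_part ang x = (\<chi> j. x $ ang j)"

definition angle_embed :: "('d::finite \<Rightarrow> 'n::finite) \<Rightarrow> complex ^ 'd \<Rightarrow> complex ^ 'n" where
  "angle_embed ang v = (\<Sum>j\<in>UNIV. axis (ang j) (v $ j))"

text \<open>On finite-dimensional spaces this is the usual notion of class \<open>C\<^sup>n\<close>.\<close>

primrec class_C :: "nat \<Rightarrow> ('a::real_normed_vector \<Rightarrow> 'b::real_normed_vector) \<Rightarrow> bool" where
  "class_C 0 g \<longleftrightarrow> continuous_on UNIV g"
| "class_C (Suc n) g \<longleftrightarrow>
     (\<exists>g'. (\<forall>x. (g has_derivative g' x) (at x)) \<and> (\<forall>v. class_C n (\<lambda>x. g' x v)))"

definition smooth :: "('a::real_normed_vector \<Rightarrow> 'b::real_normed_vector) \<Rightarrow> bool" where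
  "smooth g \<longleftrightarrow> (\<forall>n. class_C n g)"

definition fourier_mode ::
  "('d::finite \<Rightarrow> 'n::finite) \<Rightarrow> (int ^ 'd \<Rightarrow> real ^ 'n \<Rightarrow> complex ^ 'n) \<Rightarrow>
     int ^ 'd \<Rightarrow> real ^ 'n \<Rightarrow> complex ^ 'n" where
  "fourier_mode ang fhat k x =
     exp (\<i> * word_dot [k] (cvec (angle_part ang x))) *s fhat k (y_part ang x)"

text \<open>
  \<open>has_sum\<close> in a finite-dimensional space is absolute convergence; for each fixed \<open>y\<close> the series
  therefore converges uniformly in the angles, and the \<open>fhat k\<close> are the Fourier coefficients
  of \<open>f\<close>.
\<close>

definition fourier_expansion ::
  "('d::finite \<Rightarrow> 'n::finite) \<Rightarrow> (real ^ 'n \<Rightarrow> real ^ 'n) \<Rightarrow>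
     (int ^ 'd \<Rightarrow> real ^ 'n \<Rightarrow> complex ^ 'n) \<Rightarrow> bool" where
  "fourier_expansion ang f fhat \<longleftrightarrow>
     smooth f \<and>
     (\<forall>x j. f (x + axis (ang j) (2 * pi)) = f x) \<and>
     (\<forall>k. smooth (\<lambda>x. fhat k (y_part ang x))) \<and>
     (\<forall>k x. fhat (- k) (y_part ang x) = (\<chi> i. cnj (fhat k (y_part ang x) $ i))) \<and>
     (\<forall>x. ((\<lambda>k. fourier_mode ang fhat k x) has_sum cvec (f x)) UNIV)"

section \<open>Word-basis functions and word series\<close>

definition jacobian :: "(real ^ ('n::finite) \<Rightarrow> complex ^ ('m::finite)) \<Rightarrow> real ^ 'n \<Rightarrow> complex ^ 'n ^ 'm" where
  "jacobian g x = (\<chi> i j. frechet_derivative g (at x) (axis j 1) $ i)"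

fun word_fun ::
  "('k \<Rightarrow> real ^ ('n::finite) \<Rightarrow> complex ^ 'n) \<Rightarrow> 'k list \<Rightarrow> real ^ 'n \<Rightarrow> complex ^ 'n" where
  "word_fun F [] x = cvec x"
| "word_fun F [k] x = F k x"
| "word_fun F (k # l # w) x = jacobian (word_fun F (l # w)) x *v F k x"

text \<open>
  A formal series is a family of functions indexed by multisets of letters: give each \<open>F k\<close> its
  own formal parameter \<open>\<epsilon>\<^sub>k\<close>; the component at \<open>M\<close> is then the coefficient of the monomial
  \<open>\<Prod>k\<in>#M. \<epsilon>\<^sub>k\<close>, to which exactly the finitely many rearrangements of \<open>M\<close> contribute.  Collecting
  all \<open>M\<close> of size \<open>n\<close> gives the coefficient of \<open>\<epsilon>\<^sup>n\<close>, which is itself a formal infinite sum.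
\<close>

type_synonym ('k, 'n) formal_series = "'k multiset \<Rightarrow> real ^ 'n \<Rightarrow> complex ^ 'n"

definition word_series ::
  "(int ^ ('d::finite) \<Rightarrow> real ^ ('n::finite) \<Rightarrow> complex ^ 'n) \<Rightarrow> 'd coeff \<Rightarrow> (int ^ 'd, 'n) formal_series" where
  "word_series F \<delta> M x = (\<Sum>w | mset w = M. \<delta> w *s word_fun F w x)"

fun ext_word_series ::
  "('d::finite \<Rightarrow> 'n::finite) \<Rightarrow> (int ^ 'd \<Rightarrow> real ^ 'n \<Rightarrow> complex ^ 'n) \<Rightarrow> 'd ext_coeff \<Rightarrow>
     (int ^ 'd, 'n) formal_series" where
  "ext_word_series ang F (v, \<delta>) M x =
     (if M = {#} then angle_embed ang v else 0) + word_series F \<delta> M x"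

section \<open>Hamiltonian structure\<close>

text \<open>
  Coordinates \<open>x = (p\<^sup>1, \<dots>, p\<^sup>m; q\<^sup>1, \<dots>, q\<^sup>m; a\<^sup>1, \<dots>, a\<^sup>d; \<theta>\<^sup>1, \<dots>, \<theta>\<^sup>d)\<close>: the maps \<open>p\<close>, \<open>q\<close> (on
  \<open>{..<m}\<close>), \<open>a\<close> and \<open>ang\<close> enumerate all coordinates of \<open>real ^ 'n\<close> without repetition, so that
  \<open>CARD('n) = 2 * m + 2 * CARD('d)\<close>.
\<close>

definition canonical_coords ::
  "nat \<Rightarrow> (nat \<Rightarrow> 'n::finite) \<Rightarrow> (nat \<Rightarrow> 'n) \<Rightarrow> ('d::finite \<Rightarrow> 'n) \<Rightarrow> ('d \<Rightarrow> 'n) \<Rightarrow> bool" where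
  "canonical_coords m p q a ang \<longleftrightarrow>
     bij_betw (case_sum (case_sum p q) (case_sum a ang))
       (({..<m} <+> {..<m}) <+> (UNIV <+> UNIV)) UNIV"

text \<open>
  With all momenta before all positions this is \<open>J = [[0, I], [-I, 0]]\<close>, so that
  \<open>x' = J\<^sup>-\<^sup>1 \<nabla>H\<close> reads \<open>p' = - \<partial>H/\<partial>q\<close>, \<open>q' = \<partial>H/\<partial>p\<close>, \<open>a' = - \<partial>H/\<partial>\<theta>\<close>, \<open>\<theta>' = \<partial>H/\<partial>a\<close>.
\<close>

definition symplectic_matrix ::
  "nat \<Rightarrow> (nat \<Rightarrow> 'n::finite) \<Rightarrow> (nat \<Rightarrow> 'n) \<Rightarrow> ('d::finite \<Rightarrow> 'n) \<Rightarrow> ('d \<Rightarrow> 'n) \<Rightarrow> complex ^ 'n ^ 'n" where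
  "symplectic_matrix m p q a ang =
     (let conj = (\<lambda>i j. (\<exists>l<m. i = p l \<and> j = q l) \<or> (\<exists>l. i = a l \<and> j = ang l))
      in (\<chi> i j. if conj i j then 1 else if conj j i then - 1 else 0))"

definition gradient :: "(real ^ ('n::finite) \<Rightarrow> complex) \<Rightarrow> real ^ 'n \<Rightarrow> complex ^ 'n" where
  "gradient H x = (\<chi> j. frechet_derivative H (at x) (axis j 1))"

definition hamiltonian_field ::
  "complex ^ ('n::finite) ^ 'n \<Rightarrow> (real ^ 'n \<Rightarrow> complex ^ 'n) \<Rightarrow> bool" where
  "hamiltonian_field J g \<longleftrightarrow>
     (\<exists>H. smooth H \<and> (\<forall>x. g x = matrix_inv J *v gradient H x))"

text \<open>The Hamiltonian of a formal vector field is the formal series of the \<open>H\<close> of its components.\<close>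

definition formal_hamiltonian ::
  "complex ^ ('n::finite) ^ 'n \<Rightarrow> ('k, 'n) formal_series \<Rightarrow> bool" where
  "formal_hamiltonian J \<Phi> \<longleftrightarrow> (\<forall>M. hamiltonian_field J (\<Phi> M))"

text \<open>
  \<open>(\<partial>\<Phi>)\<^sup>T J (\<partial>\<Phi>) = J\<close> as an identity of formal series: products of series are Cauchy products
  over the splittings \<open>M = N + (M - N)\<close>.
\<close>

definition formal_symplectic ::
  "complex ^ ('n::finite) ^ 'n \<Rightarrow> ('k, 'n) formal_series \<Rightarrow> bool" where
  "formal_symplectic J \<Phi> \<longleftrightarrow>
     (\<forall>M. smooth (\<Phi> M)) \<and>
     (\<forall>M x. (\<Sum>N | N \<subseteq># M. transpose (jacobian (\<Phi> N) x) ** J ** jacobian (\<Phi> (M - N)) x) =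
            (if M = {#} then J else 0))"

end

theory Submission
  imports Defs
begin

text \<open>
  The normal form is built in the algebra of words; the phase space enters only in the Hamiltonian
  part.

  Deconcatenation is compatible with the shuffle product (lemma \<open>copr_conv\<close>), so membership in
  the group \<open>grp\<close> or the Lie algebra \<open>lie\<close> says how the transpose of the shuffle product acts on a
  coefficient: a group element \<open>\<kappa>\<close> becomes \<open>\<kappa> \<otimes> \<kappa>\<close>, a Lie element \<open>\<beta>\<close> becomes
  \<open>\<beta> \<otimes> 1 + 1 \<otimes> \<beta>\<close>.  From this, commutators and conjugates by group elements of Lie elements are Lie
  elements.

  The equation \<open>\<xi>\<kappa> + \<beta>h \<star> \<kappa> = \<kappa> \<star> \<beta>\<close> can be solved word by word, but on resonant words \<open>\<kappa>\<close> is
  free, and an arbitrary choice destroys the shuffle relations.  Instead \<open>\<kappa>\<close> is generated by a Lie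
  element \<open>\<mu>\<close>: with the derivation \<open>E\<close> that multiplies by the word length, \<open>\<kappa>\<close> is the solution of
  \<open>E\<kappa> = \<mu> \<star> \<kappa>\<close>, which is automatically in \<open>grp\<close> (lemma \<open>gen_in_grp\<close>).  Applying \<open>E\<close> to the equation
  for \<open>\<kappa>\<close> turns it into the homological equation
  \<open>\<xi>\<mu> + E\<beta>h = \<mu> \<star> \<beta>h - \<beta>h \<star> \<mu> + \<kappa> \<star> E\<beta> \<star> \<kappa>\<^sup>-\<^sup>1\<close>.  Its right-hand side is a Lie element, and on words
  of length \<open>n\<close> it depends on \<open>\<mu>\<close> and \<open>\<beta>h\<close> only through shorter words.  Letting \<open>\<mu>\<close> absorb the
  non-resonant words and \<open>\<beta>h\<close> the resonant ones gives a map of \<open>lie \<times> lie\<close> into itself that gains one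
  letter at every step; its iterates become stationary at every word, and the limit is a fixed point
  (lemma \<open>normal_fixpoint\<close>).  Conversely, the defect \<open>Z\<close> of the equation for \<open>\<kappa>\<close> then satisfies
  \<open>EZ = \<mu> \<star> Z\<close> and \<open>Z = 0\<close> at the empty word, hence vanishes (theorem \<open>normal_form_exists\<close>).

  Since \<open>\<beta>h\<close> lives on resonant words, it is fixed by all \<open>\<Xi>\<close> along \<open>\<omega>\<close>; so the equation for the
  solution of the transformed system and the equation for the flow of \<open>\<beta>h\<close> coincide.  They are solved
  by \<open>exp (t\<beta>h)\<close>, and only by it, by induction on the length of words.

  For the Hamiltonian part let \<open>L\<close> denote the Lie derivative of a covariant 2-tensor.  Word functions
  are iterated derivatives of the coordinates, so by the Leibniz rule \<open>L\<close> along
  \<open>k\<^sub>1\<close>, ..., \<open>k\<^sub>n\<close> of the constant form \<open>J\<close> is the sum of \<open>(\<partial>f\<^sub>u)\<^sup>T J (\<partial>f\<^sub>v)\<close> over all ways of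
  splitting the word into two complementary subwords \<open>u\<close>, \<open>v\<close>.  Hamiltonian fields preserve \<open>J\<close>, so
  this sum vanishes for every nonempty word (lemma \<open>pullback_word_eq_0\<close>).  Weighting it with a group
  element gives \<open>(\<partial>\<Phi>)\<^sup>T J (\<partial>\<Phi>) = J\<close> for \<open>\<Phi> = W\<^sub>\<kappa>\<close>; weighting it with a Lie element leaves only the
  splittings with an empty part and gives the closedness of \<open>J W\<^sub>\<beta>\<close>, which is then a gradient by
  the Poincare lemma.
\<close>

section \<open>The shuffle product and deconcatenation\<close>

text \<open>
  The transpose of the shuffle product, a functional on pairs of words.
\<close>

definition copr :: "('d::finite) coeff \<Rightarrow> (int ^ 'd) list \<Rightarrow> (int ^ 'd) list \<Rightarrow> complex" where
  "copr \<delta> u v = (\<Sum>w\<leftarrow>shuffle u v. \<delta> w)"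

text \<open>
  Convolution for the deconcatenation of both words of a pair, that is, the product of the tensor
  square of the convolution algebra.
\<close>

definition conv2 :: "((int ^ ('d::finite)) list \<Rightarrow> (int ^ 'd) list \<Rightarrow> complex) \<Rightarrow>
    ((int ^ 'd) list \<Rightarrow> (int ^ 'd) list \<Rightarrow> complex) \<Rightarrow> (int ^ 'd) list \<Rightarrow> (int ^ 'd) list \<Rightarrow> complex" where
  "conv2 A B u v = (\<Sum>i\<le>length u. \<Sum>j\<le>length v. A (take i u) (take j v) * B (drop i u) (drop j v))"

definition tens :: "('d::finite) coeff \<Rightarrow> 'd coeff \<Rightarrow> (int ^ 'd) list \<Rightarrow> (int ^ 'd) list \<Rightarrow> complex" where
  "tens \<delta> \<eta> u v = \<delta> u * \<eta> v"

lemma shuffle_Nil2 [simp]: "shuffle xs [] = [xs]"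
  by (cases xs) auto

lemma copr_Nil1 [simp]: "copr \<delta> [] v = \<delta> v" and copr_Nil2 [simp]: "copr \<delta> u [] = \<delta> u"
  by (simp_all add: copr_def)

lemma copr_Cons: "copr \<delta> (a # u) (b # v) = copr (\<lambda>w. \<delta> (a # w)) u (b # v) + copr (\<lambda>w. \<delta> (b # w)) (a # u) v"
  by (simp add: copr_def o_def)

lemma copr_add: "copr (\<lambda>w. \<delta> w + \<eta> w) u v = copr \<delta> u v + copr \<eta> u v"
  by (simp add: copr_def sum_list_addf)

lemma copr_diff: "copr (\<lambda>w. \<delta> w - \<eta> w) u v = copr \<delta> u v - copr \<eta> u v"
  by (simp add: copr_def sum_list_subtractf)

lemma copr_cmult: "copr (\<lambda>w. c * \<delta> w) u v = c * copr \<delta> u v"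
  by (simp add: copr_def sum_list_const_mult)

lemma copr_cong:
  assumes "\<And>w. w \<in> shuffles u v \<Longrightarrow> \<delta> w = \<eta> w"
  shows "copr \<delta> u v = copr \<eta> u v"
  unfolding copr_def by (intro arg_cong[where f = sum_list] map_cong) (auto simp: set_shuffle assms)

lemma conv_Cons: "(\<delta> \<star> \<eta>) (a # w) = \<delta> [] * \<eta> (a # w) + ((\<lambda>w. \<delta> (a # w)) \<star> \<eta>) w"
  by (simp add: conv_def sum.atMost_Suc_shift del: sum.atMost_Suc)

lemma conv2_Cons_Cons:
  "conv2 A B (a # u) (b # v) = A [] [] * B (a # u) (b # v) + (\<Sum>i\<le>length u. A (a # take i u) [] * B (drop i u) (b # v))
     + (\<Sum>j\<le>length v. A [] (b # take j v) * B (a # u) (drop j v))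
     + (\<Sum>i\<le>length u. \<Sum>j\<le>length v. A (a # take i u) (b # take j v) * B (drop i u) (drop j v))"
  by (simp add: conv2_def sum.atMost_Suc_shift sum.distrib algebra_simps del: sum.atMost_Suc)

lemma conv2_Cons1: "conv2 A B (a # u) v = (\<Sum>j\<le>length v. A [] (take j v) * B (a # u) (drop j v)) + conv2 (\<lambda>u. A (a # u)) B u v"
  by (simp add: conv2_def sum.atMost_Suc_shift del: sum.atMost_Suc)

lemma conv2_Cons2: "conv2 A B u (b # v) = (\<Sum>i\<le>length u. A (take i u) [] * B (drop i u) (b # v)) + conv2 (\<lambda>u v. A u (b # v)) B u v"
  by (simp add: conv2_def sum.atMost_Suc_shift sum.distrib del: sum.atMost_Suc)

text \<open>
  This is the bialgebra property: cutting a shuffle of \<open>u\<close> and \<open>v\<close> in two amounts to cutting both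
  \<open>u\<close> and \<open>v\<close> and shuffling the initial and the final parts separately.  It makes \<open>copr\<close>
  multiplicative.
\<close>

lemma copr_conv: "copr (\<delta> \<star> \<eta>) u v = conv2 (copr \<delta>) (copr \<eta>) u v"
proof (induction u v arbitrary: \<delta> rule: shuffle.induct)
  case (1 ys)
  then show ?case by (simp add: conv2_def conv_def)
next
  case (2 x xs)
  then show ?case by (simp add: conv2_def conv_def)
next
  case (3 x xs y ys)
  have "copr (\<delta> \<star> \<eta>) (x # xs) (y # ys) =
    copr (\<lambda>w. \<delta> [] * \<eta> (x # w) + ((\<lambda>w. \<delta> (x # w)) \<star> \<eta>) w) xs (y # ys) +
    copr (\<lambda>w. \<delta> [] * \<eta> (y # w) + ((\<lambda>w. \<delta> (y # w)) \<star> \<eta>) w) (x # xs) ys"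
    by (simp add: copr_Cons conv_Cons)
  also have "\<dots> = \<delta> [] * copr \<eta> (x # xs) (y # ys)
     + conv2 (copr (\<lambda>w. \<delta> (x # w))) (copr \<eta>) xs (y # ys)
     + conv2 (copr (\<lambda>w. \<delta> (y # w))) (copr \<eta>) (x # xs) ys"
    by (simp add: copr_add copr_cmult 3 copr_Cons algebra_simps)
  also have "\<dots> = conv2 (copr \<delta>) (copr \<eta>) (x # xs) (y # ys)"
    by (simp only: conv2_Cons_Cons conv2_Cons1[of _ _ x xs ys] conv2_Cons2[of _ _ xs y ys])
       (simp add: copr_Cons sum.distrib conv2_def algebra_simps)
  finally show ?case .
qed

lemma conv2_tens: "conv2 (tens a b) (tens c d) = tens (a \<star> c) (b \<star> d)"
  by (simp add: fun_eq_iff conv2_def tens_def conv_def sum_product mult_ac)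

lemma conv_assoc: "(a \<star> b) \<star> c = a \<star> (b \<star> c)"
proof
  fix w show "((a \<star> b) \<star> c) w = (a \<star> (b \<star> c)) w"
  proof (induction w arbitrary: a)
    case Nil then show ?case by (simp add: conv_def)
  next
    case (Cons x w)
    have linear: "((\<lambda>w. p * b' w + q w) \<star> c) w = p * (b' \<star> c) w + (q \<star> c) w" for p b' q
      by (simp add: conv_def sum.distrib sum_distrib_left algebra_simps)
    have "((a \<star> b) \<star> c) (x # w) = a [] * (b [] * c (x # w) + ((\<lambda>w. b (x # w)) \<star> c) w) + (((\<lambda>w. a (x # w)) \<star> b) \<star> c) w"
      by (simp only: conv_Cons linear) (simp add: conv_def algebra_simps)
    then show ?case by (simp only: Cons conv_Cons)
  qed
qed

lemma unit_conv [simp]: "unit_coeff \<star> \<delta> = \<delta>"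
proof
  fix w show "(unit_coeff \<star> \<delta>) w = \<delta> w"
  proof (cases w)
    case (Cons a u)
    have "((\<lambda>w. unit_coeff (a # w)) \<star> \<delta>) u = 0" by (simp add: conv_def unit_coeff_def)
    then show ?thesis using Cons by (simp only: conv_Cons) (simp add: unit_coeff_def)
  qed (simp add: conv_def unit_coeff_def)
qed

lemma conv_unit [simp]: "\<delta> \<star> unit_coeff = \<delta>"
proof
  fix w
  have "(\<delta> \<star> unit_coeff) w = (\<Sum>j\<le>length w. if j = length w then \<delta> w else 0)"
    unfolding conv_def by (rule sum.cong) (auto simp: unit_coeff_def)
  then show "(\<delta> \<star> unit_coeff) w = \<delta> w" by simp
qed

lemma conv_Nil [simp]: "(\<delta> \<star> \<eta>) [] = \<delta> [] * \<eta> []"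
  by (simp add: conv_def)

lemma conv_add_left: "((\<lambda>w. \<delta> w + \<delta>' w) \<star> \<eta>) w = (\<delta> \<star> \<eta>) w + (\<delta>' \<star> \<eta>) w"
  and conv_add_right: "(\<eta> \<star> (\<lambda>w. \<delta> w + \<delta>' w)) w = (\<eta> \<star> \<delta>) w + (\<eta> \<star> \<delta>') w"
  and conv_diff_left: "((\<lambda>w. \<delta> w - \<delta>' w) \<star> \<eta>) w = (\<delta> \<star> \<eta>) w - (\<delta>' \<star> \<eta>) w"
  and conv_diff_right: "(\<eta> \<star> (\<lambda>w. \<delta> w - \<delta>' w)) w = (\<eta> \<star> \<delta>) w - (\<eta> \<star> \<delta>') w"
  by (simp_all add: conv_def sum.distrib sum_subtractf algebra_simps)

lemma conv_split_last: "(\<delta> \<star> \<eta>) w = \<delta> w * \<eta> [] + (\<Sum>j<length w. \<delta> (take j w) * \<eta> (drop j w))"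
  by (simp add: conv_def lessThan_Suc_atMost[symmetric])

lemma conv_split_first: "\<delta> [] = 0 \<Longrightarrow> (\<delta> \<star> \<eta>) w = (\<Sum>j\<in>{1..length w}. \<delta> (take j w) * \<eta> (drop j w))"
  unfolding conv_def by (rule sum.mono_neutral_right) (auto simp: not_less_eq_eq)

text \<open>
  Group elements are the grouplike ones and Lie elements (next lemma) the primitive ones, which makes
  both notions accessible to computation in the tensor square.
\<close>

lemma grp_iff: "\<gamma> \<in> grp \<longleftrightarrow> \<gamma> [] = 1 \<and> copr \<gamma> = tens \<gamma> \<gamma>"
  by (auto simp: grp_def copr_def tens_def fun_eq_iff)

lemma lie_iff: "\<beta> \<in> lie \<longleftrightarrow> \<beta> [] = 0 \<and> copr \<beta> = (\<lambda>u v. tens \<beta> unit_coeff u v + tens unit_coeff \<beta> u v)"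
proof -
  have "copr \<beta> u v = tens \<beta> unit_coeff u v + tens unit_coeff \<beta> u v"
    if "\<beta> [] = 0" "u = [] \<or> v = []" for u v
    using that by (auto simp: tens_def unit_coeff_def)
  then show ?thesis
    unfolding lie_def fun_eq_iff copr_def[symmetric] by (auto simp: tens_def unit_coeff_def)
qed

lemma lie_Nil: "\<beta> \<in> lie \<Longrightarrow> \<beta> [] = 0"
  by (simp add: lie_def)

lemma conv2_add_left: "conv2 (\<lambda>u v. A u v + A' u v) B u v = conv2 A B u v + conv2 A' B u v"
  and conv2_add_right: "conv2 B (\<lambda>u v. A u v + A' u v) u v = conv2 B A u v + conv2 B A' u v"
  by (simp_all add: conv2_def sum.distrib algebra_simps)

lemma commutator_in_lie:
  assumes "\<mu> \<in> lie" "\<beta> \<in> lie"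
  shows "(\<lambda>w. (\<mu> \<star> \<beta>) w - (\<beta> \<star> \<mu>) w) \<in> lie"
proof -
  have *: "\<mu> [] = 0" "copr \<mu> = (\<lambda>u v. tens \<mu> unit_coeff u v + tens unit_coeff \<mu> u v)"
    "\<beta> [] = 0" "copr \<beta> = (\<lambda>u v. tens \<beta> unit_coeff u v + tens unit_coeff \<beta> u v)"
    using assms by (auto simp: lie_iff)
  have "copr (\<mu> \<star> \<beta>) u v - copr (\<beta> \<star> \<mu>) u v =
     tens (\<mu> \<star> \<beta>) unit_coeff u v - tens (\<beta> \<star> \<mu>) unit_coeff u v + tens unit_coeff (\<mu> \<star> \<beta>) u v - tens unit_coeff (\<beta> \<star> \<mu>) u v" for u v
    by (simp add: copr_conv * conv2_add_left conv2_add_right conv2_tens)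
  then show ?thesis
    by (simp add: lie_iff copr_diff fun_eq_iff *) (simp add: tens_def algebra_simps)
qed

text \<open>
  The factor \<open>\<kappa> \<otimes> \<kappa>\<close> is 1 on the pair of empty words, so the value of \<open>A\<close> at a pair is the value of
  the product minus terms in which \<open>A\<close> is evaluated at shorter pairs.
\<close>

lemma conv2_tens_cancel:
  assumes "\<kappa> [] = 1" "conv2 A (tens \<kappa> \<kappa>) = conv2 B (tens \<kappa> \<kappa>)"
  shows "A = B"
proof -
  have "A u v = B u v" for u v
  proof (induction "length u + length v" arbitrary: u v rule: less_induct)
    case less
    \<comment> \<open>the indices \<open>(length u, length v)\<close> give the term in which \<open>A\<close> is evaluated at \<open>(u, v)\<close> itself\<close>
    let ?I = "{..length u} \<times> {..length v}"
    have split: "conv2 C (tens \<kappa> \<kappa>) u v = C u v +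
      (\<Sum>(i, j)\<in>?I - {(length u, length v)}. C (take i u) (take j v) * tens \<kappa> \<kappa> (drop i u) (drop j v))" for C
      unfolding conv2_def sum.cartesian_product
      by (subst sum.remove[of _ "(length u, length v)"]) (auto simp: tens_def assms)
    have "A (take i u) (take j v) = B (take i u) (take j v)"
      if "(i, j) \<in> ?I - {(length u, length v)}" for i j
      using that by (intro less) auto
    then have "(\<Sum>(i, j)\<in>?I - {(length u, length v)}. A (take i u) (take j v) * tens \<kappa> \<kappa> (drop i u) (drop j v))
       = (\<Sum>(i, j)\<in>?I - {(length u, length v)}. B (take i u) (take j v) * tens \<kappa> \<kappa> (drop i u) (drop j v))"
      by (intro sum.cong[OF refl]) (simp only: split_paired_all case_prod_conv)
    then show ?case using split[of A] split[of B] assms(2) by simp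
  qed
  then show ?thesis by blast
qed

text \<open>
  The element \<open>\<rho>\<close> is \<open>\<kappa> \<star> \<beta> \<star> \<kappa>\<^sup>-\<^sup>1\<close>; stating this without an inverse avoids any discussion of the
  antipode.  Both \<open>copr \<rho>\<close> and \<open>\<rho> \<otimes> 1 + 1 \<otimes> \<rho>\<close> have the same product with \<open>\<kappa> \<otimes> \<kappa>\<close>.
\<close>

lemma conjugate_in_lie:
  assumes "\<kappa> \<in> grp" "\<beta> \<in> lie" "\<rho> \<star> \<kappa> = \<kappa> \<star> \<beta>"
  shows "\<rho> \<in> lie"
proof -
  have \<kappa>: "\<kappa> [] = 1" "copr \<kappa> = tens \<kappa> \<kappa>" using assms by (auto simp: grp_iff)
  have \<beta>: "\<beta> [] = 0" "copr \<beta> = (\<lambda>u v. tens \<beta> unit_coeff u v + tens unit_coeff \<beta> u v)" using assms by (auto simp: lie_iff)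
  have "conv2 (copr \<rho>) (tens \<kappa> \<kappa>) = copr (\<kappa> \<star> \<beta>)"
    by (simp add: fun_eq_iff flip: assms(3) \<kappa>(2) copr_conv)
  also have "\<dots> = conv2 (\<lambda>u v. tens \<rho> unit_coeff u v + tens unit_coeff \<rho> u v) (tens \<kappa> \<kappa>)"
    by (simp add: fun_eq_iff copr_conv \<kappa> \<beta> conv2_add_left conv2_add_right conv2_tens assms(3))
  finally have "copr \<rho> = (\<lambda>u v. tens \<rho> unit_coeff u v + tens unit_coeff \<rho> u v)"
    using conv2_tens_cancel \<kappa>(1) by blast
  moreover have "\<rho> [] = 0"
    using fun_cong[OF assms(3), of "[]"] \<kappa> \<beta> by simp
  ultimately show ?thesis by (simp add: lie_iff)
qed

section \<open>The grading and the equation it defines\<close>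

text \<open>
  The infinitesimal generator of the scaling \<open>\<delta>\<^sub>w \<mapsto> \<epsilon>\<^sup>n \<delta>\<^sub>w\<close> of words with \<open>n\<close> letters, that is,
  \<open>\<epsilon> d/d\<epsilon>\<close> at \<open>\<epsilon> = 1\<close>.
\<close>

definition degree_op :: "('d::finite) coeff \<Rightarrow> 'd coeff" where
  "degree_op \<delta> w = of_nat (length w) * \<delta> w"

lemma degree_op_conv: "degree_op (\<delta> \<star> \<eta>) w = (degree_op \<delta> \<star> \<eta>) w + (\<delta> \<star> degree_op \<eta>) w"
proof -
  have "degree_op (\<delta> \<star> \<eta>) w = (\<Sum>j\<le>length w. degree_op \<delta> (take j w) * \<eta> (drop j w) + \<delta> (take j w) * degree_op \<eta> (drop j w))"
    unfolding degree_op_def conv_def sum_distrib_left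
    by (intro sum.cong) (auto simp: algebra_simps of_nat_diff)
  then show ?thesis by (simp add: conv_def sum.distrib)
qed

lemma word_dot_Nil [simp]: "word_dot [] v = 0"
  by (simp add: word_dot_def)

lemma word_dot_append: "word_dot (u @ v) z = word_dot u z + word_dot v z"
  by (simp add: word_dot_def sum.distrib algebra_simps)

lemma xi_conv: "xi v (\<delta> \<star> \<eta>) w = (xi v \<delta> \<star> \<eta>) w + (\<delta> \<star> xi v \<eta>) w"
proof -
  have "xi v (\<delta> \<star> \<eta>) w = (\<Sum>j\<le>length w. xi v \<delta> (take j w) * \<eta> (drop j w) + \<delta> (take j w) * xi v \<eta> (drop j w))"
    unfolding xi_def conv_def sum_distrib_left
  proof (intro sum.cong refl)
    fix j
    have "word_dot w v = word_dot (take j w) v + word_dot (drop j w) v"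
      by (metis append_take_drop_id word_dot_append)
    then show "\<i> * word_dot w v * (\<delta> (take j w) * \<eta> (drop j w)) =
         \<i> * word_dot (take j w) v * \<delta> (take j w) * \<eta> (drop j w) +
         \<delta> (take j w) * (\<i> * word_dot (drop j w) v * \<eta> (drop j w))"
      by (simp add: algebra_simps)
  qed
  then show ?thesis by (simp add: conv_def sum.distrib)
qed

lemma sum_list_shuffles:
  fixes u v :: "('a::comm_monoid_add) list"
  assumes "w \<in> shuffles u v" shows "sum_list w = sum_list u + sum_list v"
  using assms by (metis mset_shuffles sum_mset_sum_list mset_append sum_list_append)

text \<open>
  All words in a shuffle of \<open>u\<close> and \<open>v\<close> have the same length and the same sum of letters, so the
  shuffle relations survive any rescaling that depends on these two data only.  This covers the
  degree operator and the division by small divisors.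
\<close>

lemma rescale_in_lie:
  assumes "\<beta> \<in> lie"
  shows "(\<lambda>w. c (sum_list w) (length w) * \<beta> w) \<in> lie"
proof -
  have "copr (\<lambda>w. c (sum_list w) (length w) * \<beta> w) u v = c (sum_list u + sum_list v) (length u + length v) * copr \<beta> u v" for u v
    by (subst copr_cmult[symmetric], rule copr_cong) (auto simp: sum_list_shuffles length_shuffles)
  then show ?thesis using assms by (auto simp: lie_iff fun_eq_iff tens_def unit_coeff_def)
qed

lemma degree_op_in_lie: "\<beta> \<in> lie \<Longrightarrow> degree_op \<beta> \<in> lie"
  using rescale_in_lie[of \<beta> "\<lambda>s n. of_nat n"] by (simp add: degree_op_def[abs_def])

lemma degree_equation_unique:
  assumes "\<mu> [] = 0" "\<And>w. degree_op Z w = (\<mu> \<star> Z) w" "Z [] = 0"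
  shows "Z w = 0"
proof (induction "length w" arbitrary: w rule: less_induct)
  case less
  show ?case
  proof (cases "w = []")
    case False
    have "(\<mu> \<star> Z) w = (\<Sum>j\<in>{1..length w}. \<mu> (take j w) * Z (drop j w))"
      using assms(1) by (rule conv_split_first)
    also have "\<dots> = 0" using less by (intro sum.neutral) (auto simp: Suc_le_eq)
    finally show ?thesis using assms(2)[of w] False by (simp add: degree_op_def)
  qed (use assms in simp)
qed

text \<open>
  The solution \<open>\<kappa>\<close> of \<open>degree_op \<kappa> = \<mu> \<star> \<kappa>\<close> with value 1 at the empty word, as shown by
  \<open>degree_op_gen\<close> below.
\<close>

fun gen :: "('d::finite) coeff \<Rightarrow> 'd coeff" where
  "gen \<mu> w = (if w = [] then 1 else (\<Sum>j\<in>{1..length w}. \<mu> (take j w) * gen \<mu> (drop j w)) / of_nat (length w))"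

declare gen.simps [simp del]

lemma gen_Nil [simp]: "gen \<mu> [] = 1" by (simp add: gen.simps)

lemma degree_op_gen: "\<mu> [] = 0 \<Longrightarrow> degree_op (gen \<mu>) = \<mu> \<star> gen \<mu>"
proof
  fix w assume "\<mu> [] = 0"
  then show "degree_op (gen \<mu>) w = (\<mu> \<star> gen \<mu>) w"
    by (cases "w = []") (auto simp: degree_op_def gen.simps[of \<mu> w] conv_split_first)
qed

text \<open>
  With \<open>\<kappa> = gen \<mu>\<close>, both \<open>copr \<kappa>\<close> and \<open>\<kappa> \<otimes> \<kappa>\<close> solve the same equation for the total degree,
  with generator \<open>\<mu> \<otimes> 1 + 1 \<otimes> \<mu>\<close>, and that equation determines its solution by induction on the
  total length.
\<close>

lemma gen_in_grp:
  assumes "\<mu> \<in> lie" shows "gen \<mu> \<in> grp"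
proof -
  define \<kappa> where "\<kappa> = gen \<mu>"
  define \<Lambda> where "\<Lambda> = (\<lambda>u v. tens \<mu> unit_coeff u v + tens unit_coeff \<mu> u v)"
  have \<mu>: "\<mu> [] = 0" "copr \<mu> = \<Lambda>" using assms by (auto simp: lie_iff \<Lambda>_def)
  have E: "degree_op \<kappa> = \<mu> \<star> \<kappa>" unfolding \<kappa>_def using \<mu>(1) by (rule degree_op_gen)
  \<comment> \<open>the two equations in the total degree, for \<open>copr \<kappa>\<close> and for \<open>\<kappa> \<otimes> \<kappa>\<close>\<close>
  have 1: "of_nat (length u + length v) * copr \<kappa> u v = conv2 \<Lambda> (copr \<kappa>) u v" for u v
  proof -
    have "of_nat (length u + length v) * copr \<kappa> u v = copr (degree_op \<kappa>) u v"
      unfolding copr_cmult[symmetric] by (rule copr_cong) (auto simp: degree_op_def length_shuffles)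
    then show ?thesis by (simp add: E copr_conv \<mu>)
  qed
  have 2: "of_nat (length u + length v) * tens \<kappa> \<kappa> u v = conv2 \<Lambda> (tens \<kappa> \<kappa>) u v" for u v
  proof -
    have "of_nat (length u + length v) * tens \<kappa> \<kappa> u v = tens (degree_op \<kappa>) \<kappa> u v + tens \<kappa> (degree_op \<kappa>) u v"
      by (simp add: tens_def degree_op_def algebra_simps)
    then show ?thesis by (simp add: E \<Lambda>_def conv2_add_left conv2_tens)
  qed
  have "copr \<kappa> u v = tens \<kappa> \<kappa> u v" for u v
  proof (induction "length u + length v" arbitrary: u v rule: less_induct)
    case less
    show ?case
    proof (cases "u = [] \<and> v = []")
      case True then show ?thesis by (simp add: tens_def \<kappa>_def)
    next
      case False
      have "conv2 \<Lambda> (copr \<kappa>) u v = conv2 \<Lambda> (tens \<kappa> \<kappa>) u v"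
        unfolding conv2_def
      proof (intro sum.cong refl)
        fix i j assume ij: "i \<in> {..length u}" "j \<in> {..length v}"
        show "\<Lambda> (take i u) (take j v) * copr \<kappa> (drop i u) (drop j v) = \<Lambda> (take i u) (take j v) * tens \<kappa> \<kappa> (drop i u) (drop j v)"
        proof (cases "i = 0 \<and> j = 0")
          case True then show ?thesis by (simp add: \<Lambda>_def tens_def \<mu>)
        next
          case False
          then have "copr \<kappa> (drop i u) (drop j v) = tens \<kappa> \<kappa> (drop i u) (drop j v)"
            using ij by (intro less) auto
          then show ?thesis by simp
        qed
      qed
      then have "of_nat (length u + length v) * copr \<kappa> u v = of_nat (length u + length v) * tens \<kappa> \<kappa> u v"
        using 1 2 by metis
      moreover have "of_nat (length u + length v) \<noteq> (0::complex)" using False by (metis add_is_0 length_0_conv of_nat_eq_0_iff)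
      ultimately show ?thesis by simp
    qed
  qed
  then show ?thesis unfolding grp_iff \<kappa>_def by (auto simp: fun_eq_iff)
qed

text \<open>
  The right quotient \<open>\<eta> \<star> \<kappa>\<^sup>-\<^sup>1\<close>, for \<open>\<kappa>\<close> with value 1 at the empty word.
\<close>

fun rdiv :: "('d::finite) coeff \<Rightarrow> 'd coeff \<Rightarrow> 'd coeff" where
  "rdiv \<eta> \<kappa> w = \<eta> w - (\<Sum>j<length w. rdiv \<eta> \<kappa> (take j w) * \<kappa> (drop j w))"

declare rdiv.simps [simp del]

lemma rdiv_Nil [simp]: "rdiv \<eta> \<kappa> [] = \<eta> []"
  by (subst rdiv.simps) simp

lemma rdiv_conv: "\<kappa> [] = 1 \<Longrightarrow> rdiv \<eta> \<kappa> \<star> \<kappa> = \<eta>"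
  by (rule ext, subst conv_split_last) (subst rdiv.simps, simp)

section \<open>Agreement on short words\<close>

definition agree_below :: "nat \<Rightarrow> ('d::finite) coeff \<Rightarrow> 'd coeff \<Rightarrow> bool" where
  "agree_below n a b \<longleftrightarrow> (\<forall>w. length w < n \<longrightarrow> a w = b w)"

text \<open>
  In this lemma, in the next one and in \<open>agree_below_rdiv\<close> a letter is gained: a coefficient that
  vanishes at the empty word forces the other factor to be evaluated at a strictly shorter word.
\<close>

lemma agree_below_conv:
  assumes "agree_below n a a'" "agree_below n b b'" "a [] = 0" "a' [] = 0" "b [] = 0" "b' [] = 0"
  shows "agree_below (Suc n) (a \<star> b) (a' \<star> b')"
  unfolding agree_below_def conv_def
proof (intro allI impI sum.cong refl)
  fix w :: "(int ^ 'a) list" and j assume w: "length w < Suc n" and "j \<in> {..length w}"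
  then consider "j = 0" | "j = length w" | "0 < j" "j < length w" by fastforce
  then show "a (take j w) * b (drop j w) = a' (take j w) * b' (drop j w)"
    using assms w by cases (auto simp: agree_below_def)
qed

lemma agree_below_conv_right:
  assumes "agree_below n a a'" "b [] = 0"
  shows "agree_below (Suc n) (a \<star> b) (a' \<star> b)"
  using assms by (auto simp: agree_below_def conv_split_last)

lemma agree_below_gen:
  assumes "agree_below n a a'" shows "agree_below n (gen a) (gen a')"
proof -
  have "length w < n \<Longrightarrow> gen a w = gen a' w" for w
  proof (induction "length w" arbitrary: w rule: less_induct)
    case less
    have "(\<Sum>j\<in>{1..length w}. a (take j w) * gen a (drop j w)) = (\<Sum>j\<in>{1..length w}. a' (take j w) * gen a' (drop j w))"
      using less assms by (intro sum.cong refl) (auto simp: agree_below_def Suc_le_eq)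
    then show ?case by (simp add: gen.simps[of _ w])
  qed
  then show ?thesis by (simp add: agree_below_def)
qed

lemma agree_below_rdiv:
  assumes "agree_below (Suc n) \<eta> \<eta>'" "\<eta> [] = 0" "\<eta>' [] = 0" "agree_below n \<kappa> \<kappa>'"
  shows "agree_below (Suc n) (rdiv \<eta> \<kappa>) (rdiv \<eta>' \<kappa>')"
proof -
  have "length w < Suc n \<Longrightarrow> rdiv \<eta> \<kappa> w = rdiv \<eta>' \<kappa>' w" for w
  proof (induction "length w" arbitrary: w rule: less_induct)
    case less
    have "(\<Sum>j<length w. rdiv \<eta> \<kappa> (take j w) * \<kappa> (drop j w)) = (\<Sum>j<length w. rdiv \<eta>' \<kappa>' (take j w) * \<kappa>' (drop j w))"
    proof (intro sum.cong refl)
      fix j assume j: "j \<in> {..<length w}"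
      show "rdiv \<eta> \<kappa> (take j w) * \<kappa> (drop j w) = rdiv \<eta>' \<kappa>' (take j w) * \<kappa>' (drop j w)"
      proof (cases "j = 0")
        case True then show ?thesis using assms by simp
      next
        case False
        then have "rdiv \<eta> \<kappa> (take j w) = rdiv \<eta>' \<kappa>' (take j w)" using less j by auto
        moreover have "\<kappa> (drop j w) = \<kappa>' (drop j w)" using False less j assms(4) by (auto simp: agree_below_def)
        ultimately show ?thesis by simp
      qed
    qed
    then show ?case using less assms(1) by (simp add: rdiv.simps[of _ _ w] agree_below_def)
  qed
  then show ?thesis by (simp add: agree_below_def)
qed

text \<open>
  Each shuffle relation involves words of one length only, so it passes to limits that are
  stationary at each word.
\<close>

lemma lie_limit:
  assumes "\<And>n. agree_below n L (s n)" "\<And>n. s n \<in> lie"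
  shows "L \<in> lie"
proof -
  have "copr L u v = tens L unit_coeff u v + tens unit_coeff L u v" for u v
  proof -
    define n where "n = Suc (length u + length v)"
    have "copr L u v = copr (s n) u v"
      by (rule copr_cong) (use assms(1)[of n] in \<open>auto simp: n_def agree_below_def length_shuffles\<close>)
    moreover have "L u = s n u" "L v = s n v" using assms(1)[of n] by (auto simp: agree_below_def n_def)
    ultimately show ?thesis using assms(2)[of n] by (auto simp: lie_iff tens_def)
  qed
  moreover have "L [] = s 1 []" using assms(1)[of 1] by (auto simp: agree_below_def)
  ultimately show ?thesis using assms(2)[of 1] by (auto simp: lie_iff)
qed

section \<open>The homological equation\<close>

text \<open>
  The right-hand side of the homological equation, with \<open>b\<close> in the role of the normal form: the
  commutator of \<open>\<mu>\<close> and \<open>b\<close> plus the conjugate of \<open>degree_op \<beta>\<close> by \<open>gen \<mu>\<close>.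
\<close>

definition normal_rhs :: "('d::finite) coeff \<Rightarrow> 'd coeff \<Rightarrow> 'd coeff \<Rightarrow> 'd coeff" where
  "normal_rhs \<beta> \<mu> b w = (\<mu> \<star> b) w - (b \<star> \<mu>) w + rdiv (gen \<mu> \<star> degree_op \<beta>) (gen \<mu>) w"

text \<open>
  For a right-hand side \<open>R\<close>, \<open>nonres_part\<close> inverts \<open>xi\<close> on the words where it is invertible,
  and \<open>res_part\<close> inverts the degree operator on the remaining ones.
\<close>

definition nonres_part :: "complex ^ ('d::finite) \<Rightarrow> 'd coeff \<Rightarrow> 'd coeff" where
  "nonres_part v R w = (if word_dot w v = 0 then 0 else R w / (\<i> * word_dot w v))"

text \<open>
  At the empty word, which is resonant and has length 0, the quotient is 0 by convention.
\<close>

definition res_part :: "complex ^ ('d::finite) \<Rightarrow> 'd coeff \<Rightarrow> 'd coeff" where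
  "res_part v R w = (if word_dot w v = 0 then R w / of_nat (length w) else 0)"

primrec normal_iter :: "complex ^ ('d::finite) \<Rightarrow> 'd coeff \<Rightarrow> nat \<Rightarrow> 'd coeff \<times> 'd coeff" where
  "normal_iter v \<beta> 0 = (\<lambda>_. 0, \<lambda>_. 0)"
| "normal_iter v \<beta> (Suc n) = (let R = normal_rhs \<beta> (fst (normal_iter v \<beta> n)) (snd (normal_iter v \<beta> n))
     in (nonres_part v R, res_part v R))"

lemma lie_add: "a \<in> lie \<Longrightarrow> b \<in> lie \<Longrightarrow> (\<lambda>w. a w + b w) \<in> lie"
  by (simp add: lie_iff copr_add fun_eq_iff tens_def algebra_simps)

lemma lie_zero: "(\<lambda>_. 0) \<in> lie"
  by (simp add: lie_iff copr_def tens_def fun_eq_iff)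

lemma normal_rhs_in_lie:
  assumes "\<beta> \<in> lie" "\<mu> \<in> lie" "b \<in> lie"
  shows "normal_rhs \<beta> \<mu> b \<in> lie"
proof -
  have "rdiv (gen \<mu> \<star> degree_op \<beta>) (gen \<mu>) \<in> lie"
    using gen_in_grp[OF assms(2)] degree_op_in_lie[OF assms(1)] by (rule conjugate_in_lie) (simp add: rdiv_conv)
  with commutator_in_lie[OF assms(2,3)] show ?thesis
    unfolding normal_rhs_def[abs_def] by (rule lie_add)
qed

lemma word_dot_sum_list: "word_dot [sum_list w] v = word_dot w v"
  by (simp add: word_dot_def)

lemma nonres_part_in_lie: assumes "R \<in> lie" shows "nonres_part v R \<in> lie"
proof -
  let ?c = "\<lambda>s n. if word_dot [s] v = 0 then 0 else 1 / (\<i> * word_dot [s] v)"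
  have "nonres_part v R = (\<lambda>w. ?c (sum_list w) (length w) * R w)"
    unfolding word_dot_sum_list by (rule ext) (simp add: nonres_part_def)
  then show ?thesis using rescale_in_lie[OF assms, of ?c] by (simp only:)
qed

lemma res_part_in_lie: assumes "R \<in> lie" shows "res_part v R \<in> lie"
proof -
  let ?c = "\<lambda>s n. if word_dot [s] v = 0 then 1 / of_nat n else 0"
  have "res_part v R = (\<lambda>w. ?c (sum_list w) (length w) * R w)"
    unfolding word_dot_sum_list by (rule ext) (simp add: res_part_def)
  then show ?thesis using rescale_in_lie[OF assms, of ?c] by (simp only:)
qed

lemma agree_below_normal_rhs:
  assumes "\<beta> \<in> lie" "\<mu> \<in> lie" "b \<in> lie" "\<mu>' \<in> lie" "b' \<in> lie"
    and "agree_below n \<mu> \<mu>'" "agree_below n b b'"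
  shows "agree_below (Suc n) (normal_rhs \<beta> \<mu> b) (normal_rhs \<beta> \<mu>' b')"
proof -
  note Nil = assms(1-5)[THEN lie_Nil]
  have "agree_below (Suc n) (\<mu> \<star> b) (\<mu>' \<star> b')" "agree_below (Suc n) (b \<star> \<mu>) (b' \<star> \<mu>')"
    using assms Nil by (auto intro!: agree_below_conv)
  moreover have "agree_below (Suc n) (rdiv (gen \<mu> \<star> degree_op \<beta>) (gen \<mu>)) (rdiv (gen \<mu>' \<star> degree_op \<beta>) (gen \<mu>'))"
    using assms by (intro agree_below_rdiv agree_below_conv_right agree_below_gen) (auto simp: degree_op_def)
  ultimately show ?thesis by (simp add: agree_below_def normal_rhs_def)
qed

text \<open>
  Starting from zero, one application of the contraction makes the iterates correct on words with
  one more letter.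
\<close>

lemma normal_fixpoint:
  assumes "\<beta> \<in> lie"
  obtains \<mu> b where "\<mu> \<in> lie" "b \<in> lie" "\<mu> = nonres_part v (normal_rhs \<beta> \<mu> b)" "b = res_part v (normal_rhs \<beta> \<mu> b)"
proof -
  define s where "s n = fst (normal_iter v \<beta> n)" for n
  define t where "t n = snd (normal_iter v \<beta> n)" for n
  have s_Suc: "s (Suc n) = nonres_part v (normal_rhs \<beta> (s n) (t n))" and t_Suc: "t (Suc n) = res_part v (normal_rhs \<beta> (s n) (t n))" for n
    by (simp_all add: s_def t_def Let_def)
  have lie: "s n \<in> lie \<and> t n \<in> lie" for n
  proof (induction n)
    case 0 then show ?case by (simp add: s_def t_def lie_zero)
  next
    case (Suc n) then show ?case using assms
      by (auto simp: s_Suc t_Suc intro!: nonres_part_in_lie res_part_in_lie normal_rhs_in_lie)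
  qed
  have contract: "agree_below (Suc n) (nonres_part v (normal_rhs \<beta> a b)) (nonres_part v (normal_rhs \<beta> a' b'))
     \<and> agree_below (Suc n) (res_part v (normal_rhs \<beta> a b)) (res_part v (normal_rhs \<beta> a' b'))"
    if "a \<in> lie" "b \<in> lie" "a' \<in> lie" "b' \<in> lie" "agree_below n a a'" "agree_below n b b'" for n a b a' b'
    using agree_below_normal_rhs[OF assms that] by (simp add: agree_below_def nonres_part_def res_part_def)
  have contraction_step: "agree_below n (s n) (s (Suc n)) \<and> agree_below n (t n) (t (Suc n))" for n
  proof (induction n)
    case 0 then show ?case by (simp add: agree_below_def)
  next
    case (Suc n)
    show ?case
      using contract[of "s n" "t n" "s (Suc n)" "t (Suc n)" n, folded s_Suc t_Suc] lie Suc by simp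
  qed
  have stable: "s m w = s n w \<and> t m w = t n w" if "length w < n" "n \<le> m" for m n w
    using that(2)
  proof (induction m rule: dec_induct)
    case (step m)
    then have "length w < m" using that(1) by simp
    then show ?case using contraction_step[of m] step by (simp add: agree_below_def)
  qed simp
  define \<mu> where "\<mu> w = s (Suc (length w)) w" for w
  define b where "b w = t (Suc (length w)) w" for w
  have ag: "agree_below n \<mu> (s n)" "agree_below n b (t n)" for n
    using stable[of _ "Suc (length _)" n] unfolding agree_below_def \<mu>_def b_def
    by (metis Suc_leI lessI)+
  have L: "\<mu> \<in> lie" "b \<in> lie"
    using lie_limit[of _ s] lie_limit[of _ t] ag lie by blast+
  have "\<mu> w = nonres_part v (normal_rhs \<beta> \<mu> b) w" "b w = res_part v (normal_rhs \<beta> \<mu> b) w" for w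
    using contract[OF L, of "s (length w)" "t (length w)" "length w"] lie[of "length w"] ag[of "length w"]
    unfolding s_Suc[symmetric] t_Suc[symmetric] by (auto simp: agree_below_def \<mu>_def b_def)
  then show thesis using that L by blast
qed

text \<open>
  The fixed point solves the homological equation, which is the derivative of the conjugation
  equation with respect to the degree; the conjugation equation itself is recovered because its
  defect satisfies a linear homogeneous equation in the degree.
\<close>

theorem normal_form_exists:
  assumes "\<beta> \<in> lie"
  obtains \<kappa> b where "\<kappa> \<in> grp" "b \<in> lie" "\<And>w. xi v \<kappa> w + (b \<star> \<kappa>) w = (\<kappa> \<star> \<beta>) w"
    "\<And>w. word_dot w v \<noteq> 0 \<Longrightarrow> b w = 0"
proof -
  obtain \<mu> b where L: "\<mu> \<in> lie" "b \<in> lie" and fix_\<mu>: "\<mu> = nonres_part v (normal_rhs \<beta> \<mu> b)"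
    and fix_b: "b = res_part v (normal_rhs \<beta> \<mu> b)"
    using normal_fixpoint[OF assms] .
  define \<kappa> where "\<kappa> = gen \<mu>"
  define \<rho> where "\<rho> = rdiv (\<kappa> \<star> degree_op \<beta>) \<kappa>"
  have \<rho>: "\<rho> \<star> \<kappa> = \<kappa> \<star> degree_op \<beta>" unfolding \<rho>_def by (rule rdiv_conv) (simp add: \<kappa>_def)
  have \<kappa>: "\<kappa> \<in> grp" "degree_op \<kappa> = \<mu> \<star> \<kappa>"
    using L by (auto simp: \<kappa>_def gen_in_grp degree_op_gen lie_Nil)
  \<comment> \<open>the two fixed point equations combine to the homological equation\<close>
  have key: "xi v \<mu> w + degree_op b w = (\<mu> \<star> b) w - (b \<star> \<mu>) w + \<rho> w" for w
  proof (cases "w = []")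
    case True
    have "\<rho> [] = 0" by (simp add: \<rho>_def degree_op_def)
    then show ?thesis using True L by (simp add: lie_Nil xi_def degree_op_def)
  next
    case False
    have "normal_rhs \<beta> \<mu> b w = xi v \<mu> w + degree_op b w"
      using fun_cong[OF fix_\<mu>, of w] fun_cong[OF fix_b, of w] False
      by (cases "word_dot w v = 0") (auto simp: xi_def degree_op_def nonres_part_def res_part_def)
    then show ?thesis by (simp add: normal_rhs_def \<rho>_def \<kappa>_def)
  qed
  \<comment> \<open>the defect of the conjugation equation\<close>
  define Z where "Z w = xi v \<kappa> w + (b \<star> \<kappa>) w - (\<kappa> \<star> \<beta>) w" for w
  have "degree_op Z w = (\<mu> \<star> Z) w" for w
  proof -
    have "degree_op Z w = xi v (degree_op \<kappa>) w + degree_op (b \<star> \<kappa>) w - degree_op (\<kappa> \<star> \<beta>) w"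
      by (simp add: degree_op_def Z_def xi_def algebra_simps)
    also have "\<dots> = ((\<lambda>w. xi v \<mu> w + degree_op b w + (b \<star> \<mu>) w) \<star> \<kappa>) w + (\<mu> \<star> xi v \<kappa>) w
        - (\<mu> \<star> (\<kappa> \<star> \<beta>)) w - (\<rho> \<star> \<kappa>) w"
      by (simp add: degree_op_conv \<kappa> xi_conv \<rho> conv_add_left) (simp add: conv_assoc)
    also have "(\<lambda>w. xi v \<mu> w + degree_op b w + (b \<star> \<mu>) w) = (\<lambda>w. (\<mu> \<star> b) w + \<rho> w)"
      using key by (auto simp: algebra_simps)
    also have "((\<lambda>w. (\<mu> \<star> b) w + \<rho> w) \<star> \<kappa>) w + (\<mu> \<star> xi v \<kappa>) w - (\<mu> \<star> (\<kappa> \<star> \<beta>)) w - (\<rho> \<star> \<kappa>) w = (\<mu> \<star> Z) w"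
      unfolding Z_def[abs_def] by (simp add: conv_add_left conv_diff_right conv_add_right conv_assoc)
    finally show ?thesis .
  qed
  moreover have "\<mu> [] = 0" "Z [] = 0"
    using L assms by (simp_all add: lie_Nil Z_def xi_def)
  ultimately have "Z w = 0" for w using degree_equation_unique by blast
  then have "xi v \<kappa> w + (b \<star> \<kappa>) w = (\<kappa> \<star> \<beta>) w" for w by (metis Z_def eq_iff_diff_eq_0)
  moreover have "b w = 0" if "word_dot w v \<noteq> 0" for w
    using fun_cong[OF fix_b, of w] that by (simp add: res_part_def)
  ultimately show thesis using that \<kappa>(1) L(2) by blast
qed

section \<open>Flows with resonant coefficients\<close>

lemma conv_power_Suc_right: "conv_power \<beta> (Suc n) = conv_power \<beta> n \<star> \<beta>"
proof (induction n)
  case (Suc n)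
  have "conv_power \<beta> (Suc (Suc n)) = \<beta> \<star> (conv_power \<beta> n \<star> \<beta>)"
    using Suc by (simp only: conv_power.simps(2))
  then show ?case by (simp only: conv_power.simps(2) conv_assoc)
qed simp

lemma conv_power_eq_0:
  assumes "\<beta> [] = 0" "length w < n" shows "conv_power \<beta> n w = 0"
  using assms(2)
proof (induction n arbitrary: w)
  case (Suc n)
  have "conv_power \<beta> (Suc n) w = (\<Sum>j\<in>{1..length w}. \<beta> (take j w) * conv_power \<beta> n (drop j w))"
    using assms(1) by (simp add: conv_split_first)
  also have "\<dots> = 0" using Suc by (intro sum.neutral) auto
  finally show ?case .
qed simp

lemma exp_conv_finite:
  assumes "\<beta> [] = 0" "length w \<le> N"
  shows "exp_conv t \<beta> w = (\<Sum>j\<le>N. complex_of_real (t ^ j / fact j) * conv_power \<beta> j w)"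
  unfolding exp_conv_def by (rule suminf_finite) (use assms in \<open>auto simp: conv_power_eq_0\<close>)

text \<open>
  At each word the exponential series is a polynomial in \<open>t\<close> and is differentiated term by term.
\<close>

lemma word_flow_exp_conv:
  fixes \<beta> :: "'d::finite coeff"
  assumes "\<beta> [] = 0" shows "word_flow \<beta> (\<lambda>t. exp_conv t \<beta>)"
  unfolding word_flow_def
proof (intro conjI allI)
  show "exp_conv 0 \<beta> = unit_coeff"
  proof
    fix w
    have "exp_conv 0 \<beta> w = (\<Sum>j\<le>length w. complex_of_real (0 ^ j / fact j) * conv_power \<beta> j w)"
      using assms by (rule exp_conv_finite) simp
    also have "\<dots> = (\<Sum>j\<le>length w. if j = 0 then conv_power \<beta> 0 w else 0)"
      by (rule sum.cong) auto
    finally have "exp_conv 0 \<beta> w = (\<Sum>j\<le>length w. if j = 0 then conv_power \<beta> 0 w else 0)" .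
    then show "exp_conv 0 \<beta> w = unit_coeff w" by simp
  qed
next
  fix t and w :: "(int ^ 'd) list"
  let ?n = "length w"
  \<comment> \<open>one more term than the length of \<open>w\<close> requires, so that the derivative keeps all the terms of \<open>exp_conv t \<beta> \<star> \<beta>\<close>\<close>
  have expand: "(\<lambda>s. exp_conv s \<beta> w) = (\<lambda>s. \<Sum>j\<le>Suc ?n. complex_of_real (s ^ j / fact j) * conv_power \<beta> j w)"
    by (rule ext, rule exp_conv_finite) (simp_all add: assms)
  have "((\<lambda>s. complex_of_real (s ^ j / fact j) * c) has_vector_derivative
      (if j = 0 then 0 else complex_of_real (t ^ (j - 1) / fact (j - 1)) * c)) (at t)" for j c
  proof -
    have "((\<lambda>s. s ^ j / fact j) has_real_derivative (if j = 0 then 0 else t ^ (j - 1) / fact (j - 1))) (at t)"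
      using DERIV_cdivide[OF DERIV_pow[of j t UNIV], of "fact j"] by (cases j) (simp_all add: divide_simps)
    from has_vector_derivative_scaleR[OF this has_vector_derivative_const[of c]]
    have "((\<lambda>s. (s ^ j / fact j) *\<^sub>R c) has_vector_derivative (if j = 0 then 0 else t ^ (j - 1) / fact (j - 1)) *\<^sub>R c) (at t)"
      by (simp only: scaleR_zero_right add_0)
    then show ?thesis by (simp add: scaleR_conv_of_real split: if_splits)
  qed
  then have "((\<lambda>s. exp_conv s \<beta> w) has_vector_derivative
     (\<Sum>j\<le>Suc ?n. if j = 0 then 0 else complex_of_real (t ^ (j - 1) / fact (j - 1)) * conv_power \<beta> j w)) (at t)"
    unfolding expand by (intro has_vector_derivative_sum)
  also have "(\<Sum>j\<le>Suc ?n. if j = 0 then 0 else complex_of_real (t ^ (j - 1) / fact (j - 1)) * conv_power \<beta> j w)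
     = (\<Sum>j\<le>?n. complex_of_real (t ^ j / fact j) * (conv_power \<beta> j \<star> \<beta>) w)"
    by (subst sum.atMost_Suc_shift) (simp add: conv_power_Suc_right del: conv_power.simps)
  also have "\<dots> = (\<Sum>j\<le>?n. \<Sum>i\<le>?n. complex_of_real (t ^ j / fact j) * conv_power \<beta> j (take i w) * \<beta> (drop i w))"
    by (simp add: conv_def sum_distrib_left mult.assoc)
  also have "\<dots> = (\<Sum>i\<le>?n. exp_conv t \<beta> (take i w) * \<beta> (drop i w))"
    by (subst sum.swap) (simp add: sum_distrib_right assms exp_conv_finite[of \<beta> _ ?n])
  finally show "((\<lambda>s. exp_conv s \<beta> w) has_vector_derivative (exp_conv t \<beta> \<star> \<beta>) w) (at t)"
    by (simp add: conv_def)
qed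

text \<open>
  Because \<open>\<beta>\<close> vanishes at the empty word, the derivative of a flow at \<open>w\<close> is determined by its
  values at proper prefixes of \<open>w\<close>.
\<close>

lemma word_flow_unique:
  assumes "\<beta> [] = 0" "word_flow \<beta> \<phi>" "word_flow \<beta> \<psi>" shows "\<phi> t = \<psi> t"
proof
  fix w show "\<phi> t w = \<psi> t w"
  proof (induction "length w" arbitrary: w t rule: less_induct)
    case less
    have "((\<lambda>s. \<phi> s w - \<psi> s w) has_vector_derivative 0) (at s)" for s
    proof -
      have "(\<phi> s \<star> \<beta>) w = (\<psi> s \<star> \<beta>) w" using assms(1) less by (simp add: conv_split_last)
      moreover have "((\<lambda>s. \<phi> s w - \<psi> s w) has_vector_derivative (\<phi> s \<star> \<beta>) w - (\<psi> s \<star> \<beta>) w) (at s)"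
        using assms(2,3) by (intro has_vector_derivative_diff) (simp_all add: word_flow_def)
      ultimately show ?thesis by simp
    qed
    then obtain c where "\<And>s. \<phi> s w - \<psi> s w = c"
      using has_vector_derivative_zero_constant[of UNIV "\<lambda>s. \<phi> s w - \<psi> s w"] by auto
    moreover have "\<phi> 0 w = \<psi> 0 w" using assms by (simp add: word_flow_def)
    ultimately show ?case by (metis eq_iff_diff_eq_0)
  qed
qed

definition resonant :: "complex ^ ('d::finite) \<Rightarrow> 'd coeff \<Rightarrow> bool" where
  "resonant v \<delta> \<longleftrightarrow> (\<forall>w. word_dot w v \<noteq> 0 \<longrightarrow> \<delta> w = 0)"

lemma xi_resonant: "resonant v \<delta> \<Longrightarrow> xi v \<delta> w = 0"
  by (auto simp: resonant_def xi_def)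

lemma Xi_resonant:
  assumes "resonant v \<delta>" shows "Xi (t *\<^sub>R v) \<delta> = \<delta>"
proof
  fix w
  have "word_dot w (t *\<^sub>R v) = of_real t * word_dot w v"
    unfolding word_dot_def sum_distrib_left vector_scaleR_component
    by (simp add: scaleR_conv_of_real mult_ac)
  then show "Xi (t *\<^sub>R v) \<delta> w = \<delta> w"
    using assms by (cases "word_dot w v = 0") (auto simp: Xi_def resonant_def)
qed

lemma resonant_conv:
  assumes "resonant v \<delta>" "resonant v \<eta>" shows "resonant v (\<delta> \<star> \<eta>)"
  unfolding resonant_def conv_def
proof (intro allI impI sum.neutral ballI)
  fix w j assume "word_dot w v \<noteq> 0"
  moreover have "word_dot w v = word_dot (take j w) v + word_dot (drop j w) v"
    by (metis append_take_drop_id word_dot_append)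
  ultimately have "word_dot (take j w) v \<noteq> 0 \<or> word_dot (drop j w) v \<noteq> 0" by auto
  then show "\<delta> (take j w) * \<eta> (drop j w) = 0" using assms by (auto simp: resonant_def)
qed

lemma resonant_exp_conv:
  assumes "resonant v \<beta>" shows "resonant v (exp_conv t \<beta>)"
proof -
  have "resonant v (conv_power \<beta> j)" for j
    by (induction j) (use assms in \<open>auto intro: resonant_conv, auto simp: resonant_def unit_coeff_def\<close>)
  then show ?thesis by (simp add: resonant_def exp_conv_def)
qed

lemma exp_conv_Nil: "\<beta> [] = 0 \<Longrightarrow> exp_conv t \<beta> [] = 1"
  using exp_conv_finite[of \<beta> "[]" 0 t] by (simp add: unit_coeff_def)

lemma Xi_unit [simp]: "Xi v unit_coeff = unit_coeff"
  by (auto simp: fun_eq_iff Xi_def unit_coeff_def)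

lemma Xi_zero [simp]: "Xi 0 \<delta> = \<delta>"
  by (auto simp: fun_eq_iff Xi_def word_dot_def)

lemma resonant_commuting: "resonant v b \<Longrightarrow> commuting (v, \<lambda>_. 0) (0, b)"
  by (simp add: commuting_def xi_resonant fun_eq_iff) (simp add: conv_def xi_def)

text \<open>
  In the equation for the solution, the coefficient enters through \<open>Xi\<close> along \<open>v\<close>, which fixes
  resonant coefficients.
\<close>

lemma resonant_solution_iff: "resonant v b \<Longrightarrow> ext_solution v b \<alpha> \<longleftrightarrow> word_flow b \<alpha>"
  by (simp add: ext_solution_def word_flow_def Xi_resonant)

lemma resonant_ext_mult:
  assumes "resonant v b" "b [] = 0"
  shows "(0, exp_conv t b) \<^bold>\<star> (t *\<^sub>R v, unit_coeff) = (t *\<^sub>R v, exp_conv t b)"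
    and "(t *\<^sub>R v, unit_coeff) \<^bold>\<star> (0, exp_conv t b) = (t *\<^sub>R v, exp_conv t b)"
  using Xi_resonant[OF resonant_exp_conv[OF assms(1)], of t t] assms(2)
  by (simp_all add: exp_conv_Nil unit_coeff_def)

section \<open>Smooth functions\<close>

lemma class_C_Suc_iff:
  "class_C (Suc n) g \<longleftrightarrow> (\<forall>x. g differentiable (at x)) \<and> (\<forall>v. class_C n (\<lambda>x. frechet_derivative g (at x) v))"
proof
  assume "class_C (Suc n) g"
  then obtain g' where g': "\<And>x. (g has_derivative g' x) (at x)" "\<And>v. class_C n (\<lambda>x. g' x v)" by auto
  then have "frechet_derivative g (at x) = g' x" for x by (metis frechet_derivative_at)
  then show "(\<forall>x. g differentiable (at x)) \<and> (\<forall>v. class_C n (\<lambda>x. frechet_derivative g (at x) v))"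
    using g' by (auto simp: differentiable_def)
next
  assume R: "(\<forall>x. g differentiable (at x)) \<and> (\<forall>v. class_C n (\<lambda>x. frechet_derivative g (at x) v))"
  then show "class_C (Suc n) g" unfolding class_C.simps
    by (intro exI[of _ "\<lambda>x. frechet_derivative g (at x)"]) (auto simp flip: frechet_derivative_works)
qed

lemma class_C_SucI:
  assumes "\<And>x. (g has_derivative g' x) (at x)" "\<And>v. class_C n (\<lambda>x. g' x v)"
  shows "class_C (Suc n) g"
  using assms by auto

lemma class_C_down: "class_C (Suc n) g \<Longrightarrow> class_C n g"
proof (induction n arbitrary: g)
  case 0
  then show ?case
    by (auto intro!: continuous_at_imp_continuous_on simp: class_C_Suc_iff simp del: class_C.simps(2) dest: differentiable_imp_continuous_within)
next
  case (Suc n)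
  then show ?case unfolding class_C_Suc_iff[of n g] class_C_Suc_iff[of "Suc n" g] by blast
qed

lemma smooth_iff:
  "smooth g \<longleftrightarrow> (\<forall>x. g differentiable (at x)) \<and> (\<forall>v. smooth (\<lambda>x. frechet_derivative g (at x) v))"
proof -
  have "smooth g \<longleftrightarrow> (\<forall>n. class_C (Suc n) g)"
    unfolding smooth_def using class_C_down by blast
  also have "\<dots> \<longleftrightarrow> (\<forall>x. g differentiable (at x)) \<and> (\<forall>v. smooth (\<lambda>x. frechet_derivative g (at x) v))"
    unfolding smooth_def class_C_Suc_iff by blast
  finally show ?thesis .
qed

lemma smoothI:
  assumes "\<And>x. (g has_derivative g' x) (at x)" "\<And>v. smooth (\<lambda>x. g' x v)"
  shows "smooth g"
  using class_C_SucI[OF assms(1)] assms(2) class_C_down unfolding smooth_def by blast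

lemma smooth_differentiable: "smooth g \<Longrightarrow> g differentiable (at x)"
  using smooth_iff by blast

lemma smooth_has_derivative: "smooth g \<Longrightarrow> (g has_derivative frechet_derivative g (at x)) (at x)"
  using frechet_derivative_works smooth_differentiable by blast

lemma smooth_continuous: "smooth g \<Longrightarrow> continuous_on S g"
  unfolding smooth_def using continuous_on_subset class_C.simps(1) by blast

lemma smooth_derivative: "smooth g \<Longrightarrow> smooth (\<lambda>x. frechet_derivative g (at x) v)"
  using smooth_iff by blast

lemma smooth_const [simp]: "smooth (\<lambda>x. c)"
proof -
  have "class_C n (\<lambda>x::'a. c)" for n and c :: 'b
  proof (induction n arbitrary: c)
    case (Suc n) show ?case by (rule class_C_SucI[of _ "\<lambda>x v. 0"]) (auto intro: Suc)
  qed simp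
  then show ?thesis by (simp add: smooth_def)
qed

lemma smooth_linear: "bounded_linear g \<Longrightarrow> smooth g"
  by (rule smoothI[of _ "\<lambda>x. g"]) (auto intro: bounded_linear_imp_has_derivative)

lemma smooth_compose_linear:
  assumes "bounded_linear L" "smooth g" shows "smooth (\<lambda>x. L (g x))"
proof -
  have "class_C n g \<Longrightarrow> class_C n (\<lambda>x. L (g x))" for n and g :: "'c::real_normed_vector \<Rightarrow> 'a"
  proof (induction n arbitrary: g)
    case 0 then show ?case using assms(1) by (auto intro: bounded_linear.continuous_on)
  next
    case (Suc n)
    then obtain g' where "\<And>x. (g has_derivative g' x) (at x)" "\<And>v. class_C n (\<lambda>x. g' x v)" by auto
    then show ?case using assms(1) Suc.IH
      by (intro class_C_SucI[of _ "\<lambda>x v. L (g' x v)"]) (auto intro: bounded_linear.has_derivative)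
  qed
  then show ?thesis using assms(2) by (simp add: smooth_def)
qed

lemma class_C_add:
  "class_C n f \<Longrightarrow> class_C n g \<Longrightarrow> class_C n (\<lambda>x. f x + g x)"
proof (induction n arbitrary: f g)
  case 0 then show ?case by (auto intro: continuous_on_add)
next
  case (Suc n)
  then obtain f' g' where "\<And>x. (f has_derivative f' x) (at x)" "\<And>v. class_C n (\<lambda>x. f' x v)"
    "\<And>x. (g has_derivative g' x) (at x)" "\<And>v. class_C n (\<lambda>x. g' x v)" by auto
  then show ?case using Suc.IH
    by (intro class_C_SucI[of _ "\<lambda>x v. f' x v + g' x v"]) (auto intro: has_derivative_add)
qed

lemma class_C_mult:
  fixes f g :: "'a::real_normed_vector \<Rightarrow> 'b::real_normed_algebra"
  shows "class_C n f \<Longrightarrow> class_C n g \<Longrightarrow> class_C n (\<lambda>x. f x * g x)"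
proof (induction n arbitrary: f g)
  case 0 then show ?case by (auto intro: continuous_on_mult)
next
  case (Suc n)
  then obtain f' g' where *: "\<And>x. (f has_derivative f' x) (at x)" "\<And>v. class_C n (\<lambda>x. f' x v)"
    "\<And>x. (g has_derivative g' x) (at x)" "\<And>v. class_C n (\<lambda>x. g' x v)" by auto
  show ?case
  proof (rule class_C_SucI[of _ "\<lambda>x v. f x * g' x v + f' x v * g x"])
    show "class_C n (\<lambda>x. f x * g' x v + f' x v * g x)" for v
      using Suc * class_C_down by (intro class_C_add) blast+
  qed (use * in \<open>auto intro: has_derivative_mult\<close>)
qed

lemma smooth_add: "smooth f \<Longrightarrow> smooth g \<Longrightarrow> smooth (\<lambda>x. f x + g x)"
  by (simp add: smooth_def class_C_add)

lemma smooth_mult: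
  fixes f g :: "'a::real_normed_vector \<Rightarrow> 'b::real_normed_algebra"
  shows "smooth f \<Longrightarrow> smooth g \<Longrightarrow> smooth (\<lambda>x. f x * g x)"
  by (simp add: smooth_def class_C_mult)

lemma smooth_sum: "(\<And>i. i \<in> S \<Longrightarrow> smooth (f i)) \<Longrightarrow> smooth (\<lambda>x. \<Sum>i\<in>S. f i x)"
  by (induction S rule: infinite_finite_induct) (auto intro: smooth_add)

lemma smooth_component: "smooth V \<Longrightarrow> smooth (\<lambda>x. V x $ i)"
  by (rule smooth_compose_linear) (rule bounded_linear_vec_nth)

lemma smooth_vec:
  fixes V :: "'a::real_normed_vector \<Rightarrow> complex ^ 'n::finite"
  assumes "\<And>i. smooth (\<lambda>x. V x $ i)" shows "smooth V"
proof -
  have "bounded_linear (\<lambda>c::complex. axis i c :: complex ^ 'n)" for i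
    by (intro linear_conv_bounded_linear[THEN iffD1] linearI) (auto simp: vec_eq_iff axis_def)
  then have "smooth (\<lambda>x. \<Sum>i\<in>UNIV. axis i (V x $ i))"
    using smooth_compose_linear[of "axis _"] assms by (intro smooth_sum) blast
  also have "(\<lambda>x. \<Sum>i\<in>UNIV. axis i (V x $ i)) = V"
    by (auto simp: vec_eq_iff axis_def fun_eq_iff)
  finally show ?thesis .
qed

text \<open>
  Write \<open>g (y + s b) - g y\<close> as the integral of the derivative of \<open>g\<close> in direction \<open>b\<close> over the
  segment from \<open>y\<close> to \<open>y + s b\<close>, differentiate under the integral in direction \<open>a\<close>, and then
  differentiate in \<open>s\<close> at 0.
\<close>

lemma symmetric_second_derivative:
  fixes g :: "'a::real_normed_vector \<Rightarrow> 'b::banach"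
  assumes "smooth g"
  shows "frechet_derivative (\<lambda>y. frechet_derivative g (at y) b) (at x) a
       = frechet_derivative (\<lambda>y. frechet_derivative g (at y) a) (at x) b"
proof -
  define d where "d v h y = frechet_derivative h (at y) v" for v and h :: "'a \<Rightarrow> 'b" and y
  have sm: "smooth (d v h)" if "smooth h" for v h using smooth_derivative[OF that] by (simp add: d_def[abs_def])
  have cont: "continuous_on S h" if "smooth h" for h :: "'a \<Rightarrow> 'b" and S using smooth_continuous[OF that] .
  have line: "((\<lambda>r. h (y + r *\<^sub>R v)) has_vector_derivative d v h (y + r *\<^sub>R v)) (at r within T)"
    if "smooth h" for h y v r T
  proof -
    have "((\<lambda>r. y + r *\<^sub>R v) has_vector_derivative v) (at r within T)"
      by (auto intro!: derivative_eq_intros)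
    from vector_derivative_diff_chain_within[OF this, of h "frechet_derivative h (at (y + r *\<^sub>R v))"] show ?thesis
      using smooth_has_derivative[OF that] by (auto simp: o_def d_def intro: has_derivative_at_withinI)
  qed
  have FTC: "((\<lambda>\<tau>. d b h (y + \<tau> *\<^sub>R b)) has_integral h (y + s *\<^sub>R b) - h y) {0..s}"
    if "smooth h" "0 \<le> s" for h y s
    using fundamental_theorem_of_calculus[OF that(2), of "\<lambda>\<tau>. h (y + \<tau> *\<^sub>R b)"] line[OF that(1)] by simp
  have key: "d a g (x + s *\<^sub>R b) - d a g x = integral {0..s} (\<lambda>\<tau>. d a (d b g) (x + \<tau> *\<^sub>R b))" if "0 \<le> s" for s
  proof -
    have "((\<lambda>r. integral (cbox 0 s) (\<lambda>\<tau>. d b g (x + \<tau> *\<^sub>R b + r *\<^sub>R a))) has_vector_derivative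
       integral (cbox 0 s) (\<lambda>\<tau>. d a (d b g) (x + \<tau> *\<^sub>R b + 0 *\<^sub>R a))) (at 0 within UNIV)"
    proof (rule leibniz_rule_vector_derivative)
      show "continuous_on (UNIV \<times> cbox 0 s) (\<lambda>(r, t). d a (d b g) (x + t *\<^sub>R b + r *\<^sub>R a))"
        unfolding split_beta by (intro continuous_on_compose2[OF cont[of "d a (d b g)" UNIV]] sm assms continuous_intros) auto
      show "(\<lambda>\<tau>. d b g (x + \<tau> *\<^sub>R b + r *\<^sub>R a)) integrable_on cbox 0 s" for r
        by (intro integrable_continuous continuous_on_compose2[OF cont[of "d b g" UNIV]] sm assms continuous_intros) auto
    qed (auto intro: line sm assms)
    moreover have "integral (cbox 0 s) (\<lambda>\<tau>. d b g (x + \<tau> *\<^sub>R b + r *\<^sub>R a)) = g (x + s *\<^sub>R b + r *\<^sub>R a) - g (x + r *\<^sub>R a)" for r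
      using FTC[OF assms that, of "x + r *\<^sub>R a"] by (simp add: algebra_simps integral_unique)
    ultimately have "((\<lambda>r. g (x + s *\<^sub>R b + r *\<^sub>R a) - g (x + r *\<^sub>R a)) has_vector_derivative
       integral {0..s} (\<lambda>\<tau>. d a (d b g) (x + \<tau> *\<^sub>R b))) (at 0)" by simp
    moreover have "((\<lambda>r. g (x + s *\<^sub>R b + r *\<^sub>R a) - g (x + r *\<^sub>R a)) has_vector_derivative
       d a g (x + s *\<^sub>R b + 0 *\<^sub>R a) - d a g (x + 0 *\<^sub>R a)) (at 0)"
      by (intro has_vector_derivative_diff line assms)
    ultimately show ?thesis using vector_derivative_unique_at by fastforce
  qed
  have "((\<lambda>s. integral {0..s} (\<lambda>\<tau>. d a (d b g) (x + \<tau> *\<^sub>R b))) has_vector_derivative d a (d b g) (x + 0 *\<^sub>R b)) (at 0 within {0..1})"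
    by (intro integral_has_vector_derivative continuous_on_compose2[OF cont[of "d a (d b g)" UNIV]] sm assms continuous_intros) auto
  then have "((\<lambda>s. integral {0..s} (\<lambda>\<tau>. d a (d b g) (x + \<tau> *\<^sub>R b))) has_vector_derivative d a (d b g) x) (at 0 within {0..1})"
    by simp
  then have 1: "((\<lambda>s. d a g (x + s *\<^sub>R b) - d a g x) has_vector_derivative d a (d b g) x) (at 0 within {0..1})"
    by (rule has_vector_derivative_transform[rotated 2]) (simp_all add: key)
  have 2: "((\<lambda>s. d a g (x + s *\<^sub>R b) - d a g x) has_vector_derivative d b (d a g) (x + 0 *\<^sub>R b) - 0) (at 0 within {0..1})"
    by (intro has_vector_derivative_diff line sm assms has_vector_derivative_const)
  have "d a (d b g) x = d b (d a g) x"
    using vector_derivative_unique_within_closed_interval[of 0 1 0 _ "d a (d b g) x" "d b (d a g) x"] 1 2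
    by (simp add: cbox_interval)
  then show ?thesis by (simp add: d_def[abs_def])
qed

section \<open>Partial derivatives\<close>

definition pd :: "'n::finite \<Rightarrow> (real ^ 'n \<Rightarrow> complex) \<Rightarrow> real ^ 'n \<Rightarrow> complex" where
  "pd j g x = frechet_derivative g (at x) (axis j 1)"

lemma has_derivative_imp_pd: "(g has_derivative g') (at x) \<Longrightarrow> pd j g x = g' (axis j 1)"
  unfolding pd_def by (metis frechet_derivative_at)

lemma smooth_pd: "smooth g \<Longrightarrow> smooth (pd j g)"
  unfolding pd_def[abs_def] by (rule smooth_derivative)

lemma pd_const [simp]: "pd j (\<lambda>x. c) x = 0"
  by (rule has_derivative_imp_pd[of _ "\<lambda>_. 0", simplified]) simp

lemma pd_add: "smooth f \<Longrightarrow> smooth g \<Longrightarrow> pd j (\<lambda>x. f x + g x) x = pd j f x + pd j g x"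
  by (subst has_derivative_imp_pd[OF has_derivative_add[OF smooth_has_derivative smooth_has_derivative]]) (auto simp: pd_def)

lemma pd_mult: "smooth f \<Longrightarrow> smooth g \<Longrightarrow> pd j (\<lambda>x. f x * g x) x = f x * pd j g x + pd j f x * g x"
  by (subst has_derivative_imp_pd[OF has_derivative_mult[OF smooth_has_derivative smooth_has_derivative]]) (auto simp: pd_def)

lemma pd_cmult: "smooth g \<Longrightarrow> pd j (\<lambda>x. c * g x) x = c * pd j g x"
  by (subst pd_mult) auto

lemma pd_sum: "(\<And>i. i \<in> S \<Longrightarrow> smooth (f i)) \<Longrightarrow> pd j (\<lambda>x. \<Sum>i\<in>S. f i x) x = (\<Sum>i\<in>S. pd j (f i) x)"
  by (induction S rule: infinite_finite_induct) (auto simp: pd_add smooth_sum)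

lemma pd_commute: "smooth g \<Longrightarrow> pd a (pd b g) x = pd b (pd a g) x"
  unfolding pd_def[abs_def] by (rule symmetric_second_derivative)

lemma has_derivative_coordinate: "((\<lambda>x. complex_of_real (x $ i)) has_derivative (\<lambda>v. complex_of_real (v $ i))) F"
  by (intro bounded_linear_imp_has_derivative bounded_linear_compose[OF bounded_linear_of_real bounded_linear_vec_nth])

lemma pd_coordinate: "pd j (\<lambda>x. complex_of_real (x $ i)) x = (if i = j then 1 else 0)"
  by (subst has_derivative_imp_pd[OF has_derivative_coordinate]) (simp add: axis_def)

lemma smooth_coordinate: "smooth (\<lambda>x. complex_of_real (x $ i))"
  by (intro smooth_linear bounded_linear_compose[OF bounded_linear_of_real bounded_linear_vec_nth])

lemma jacobian_component:
  assumes "smooth V" shows "jacobian V x $ i $ j = pd j (\<lambda>x. V x $ i) x"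
proof -
  have "((\<lambda>x. V x $ i) has_derivative (\<lambda>v. frechet_derivative V (at x) v $ i)) (at x)"
    by (rule bounded_linear.has_derivative[OF bounded_linear_vec_nth smooth_has_derivative[OF assms]])
  then show ?thesis by (simp add: jacobian_def has_derivative_imp_pd)
qed

section \<open>Lie derivatives along words\<close>

text \<open>
  The derivation \<open>V \<cdot> \<partial>\<close> of a complex vector field, acting on functions.
\<close>

definition along :: "(real ^ 'n \<Rightarrow> complex ^ ('n::finite)) \<Rightarrow> (real ^ 'n \<Rightarrow> complex) \<Rightarrow> real ^ 'n \<Rightarrow> complex" where
  "along V g x = (\<Sum>c\<in>UNIV. V x $ c * pd c g x)"

lemma smooth_along: "smooth V \<Longrightarrow> smooth g \<Longrightarrow> smooth (along V g)"
  unfolding along_def[abs_def] by (intro smooth_sum smooth_mult smooth_component smooth_pd)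

lemma along_mult: "smooth f \<Longrightarrow> smooth g \<Longrightarrow> along V (\<lambda>x. f x * g x) x = f x * along V g x + along V f x * g x"
  by (simp add: along_def pd_mult sum.distrib sum_distrib_left sum_distrib_right algebra_simps)

lemma along_cmult: "smooth g \<Longrightarrow> along V (\<lambda>x. c * g x) x = c * along V g x"
  by (simp add: along_def pd_cmult sum_distrib_left algebra_simps)

lemma along_add: "smooth f \<Longrightarrow> smooth g \<Longrightarrow> along V (\<lambda>x. f x + g x) x = along V f x + along V g x"
  by (simp add: along_def pd_add sum.distrib algebra_simps)

lemma along_const [simp]: "along V (\<lambda>x. c) x = 0"
  by (simp add: along_def)

lemma along_sum: "(\<And>i. i \<in> S \<Longrightarrow> smooth (f i)) \<Longrightarrow> along V (\<lambda>x. \<Sum>i\<in>S. f i x) x = (\<Sum>i\<in>S. along V (f i) x)"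
  by (induction S rule: infinite_finite_induct) (auto simp: along_add smooth_sum)

text \<open>
  The differential commutes with the Lie derivative; the sum on the right is what the Lie derivative
  of a covector adds to the derivative of its components.
\<close>

lemma pd_along:
  assumes "smooth V" "smooth g"
  shows "pd a (along V g) x = along V (pd a g) x + (\<Sum>c\<in>UNIV. pd a (\<lambda>x. V x $ c) x * pd c g x)"
proof -
  have "pd a (along V g) x = (\<Sum>c\<in>UNIV. V x $ c * pd a (pd c g) x + pd a (\<lambda>x. V x $ c) x * pd c g x)"
    unfolding along_def[abs_def]
    by (simp add: pd_sum pd_mult smooth_mult smooth_component smooth_pd assms)
  then show ?thesis by (simp add: along_def sum.distrib pd_commute[OF assms(2), of a])
qed

lemma smooth_cvec: "smooth cvec"
  by (rule smooth_vec) (simp add: cvec_def smooth_coordinate)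

lemma word_fun_Cons_if_smooth:
  assumes "smooth (word_fun F w)"
  shows "word_fun F (k # w) x $ i = along (F k) (\<lambda>x. word_fun F w x $ i) x"
proof (cases w)
  case Nil
  have "along (F k) (\<lambda>x. cvec x $ i) x = (\<Sum>c\<in>UNIV. if c = i then F k x $ c else 0)"
    unfolding along_def cvec_def by (rule sum.cong) (auto simp: pd_coordinate)
  then show ?thesis using Nil by simp
next
  case (Cons l u)
  then show ?thesis using assms
    by (simp add: matrix_vector_mult_def jacobian_component along_def mult.commute)
qed

lemma smooth_word_fun:
  assumes "\<And>k. smooth (F k)" shows "smooth (word_fun F w)"
proof (induction w)
  case Nil
  have "word_fun F [] = cvec" by (rule ext) simp
  then show ?case using smooth_cvec by simp
next
  case (Cons k w)
  show ?case
  proof (rule smooth_vec)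
    fix i show "smooth (\<lambda>x. word_fun F (k # w) x $ i)"
      unfolding word_fun_Cons_if_smooth[OF Cons] by (intro smooth_along smooth_component assms Cons)
  qed
qed

text \<open>
  The recursion for word functions holds from the empty word on because the coordinate functions
  satisfy \<open>V \<cdot> \<partial>x\<^sub>i = V\<^sub>i\<close>.
\<close>

lemma word_fun_Cons:
  assumes "\<And>k. smooth (F k)"
  shows "(\<lambda>x. word_fun F (k # w) x $ i) = along (F k) (\<lambda>x. word_fun F w x $ i)"
  by (rule ext) (rule word_fun_Cons_if_smooth[OF smooth_word_fun[OF assms]])

text \<open>
  The \<open>(a, b)\<close> entry of \<open>(\<partial>f\<^sub>u)\<^sup>T J (\<partial>f\<^sub>v)\<close>.
\<close>

definition pullback ::
  "complex ^ ('n::finite) ^ 'n \<Rightarrow> ('k \<Rightarrow> real ^ 'n \<Rightarrow> complex ^ 'n) \<Rightarrow> 'k list \<Rightarrow> 'k list \<Rightarrow> 'n \<Rightarrow> 'n \<Rightarrow> real ^ 'n \<Rightarrow> complex" where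
  "pullback J F u v a b x = (\<Sum>i\<in>UNIV. \<Sum>j\<in>UNIV. J $ i $ j *
     (pd a (\<lambda>x. word_fun F u x $ i) x * pd b (\<lambda>x. word_fun F v x $ j) x))"

text \<open>
  All ways, with multiplicity, to split a word into a subword and its complement.  This is dual to
  the shuffle product, see \<open>count_unshuffle\<close>.
\<close>

fun unshuffle :: "'a list \<Rightarrow> ('a list \<times> 'a list) list" where
  "unshuffle [] = [([], [])]"
| "unshuffle (k # w) = map (\<lambda>(u, v). (k # u, v)) (unshuffle w) @ map (\<lambda>(u, v). (u, k # v)) (unshuffle w)"

text \<open>
  The \<open>(a, b)\<close> entry of the iterated Lie derivative, along the letters of \<open>w\<close>, of the constant
  tensor \<open>J\<close>.
\<close>

definition pullback_word ::
  "complex ^ ('n::finite) ^ 'n \<Rightarrow> ('k \<Rightarrow> real ^ 'n \<Rightarrow> complex ^ 'n) \<Rightarrow> 'k list \<Rightarrow> 'n \<Rightarrow> 'n \<Rightarrow> real ^ 'n \<Rightarrow> complex" where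
  "pullback_word J F w a b x = (\<Sum>(u, v)\<leftarrow>unshuffle w. pullback J F u v a b x)"

lemma smooth_pullback:
  assumes "\<And>k. smooth (F k)" shows "smooth (pullback J F u v a b)"
  unfolding pullback_def[abs_def]
  by (intro smooth_sum smooth_mult smooth_const smooth_pd smooth_component smooth_word_fun assms)

lemma sum_swap3:
  "(\<Sum>c\<in>A. \<Sum>i\<in>B. \<Sum>j\<in>C. h c i j) = (\<Sum>i\<in>B. \<Sum>j\<in>C. \<Sum>c\<in>A. h c i j)"
  by (subst sum.swap) (intro sum.cong refl sum.swap)

text \<open>
  The right-hand side is the Lie derivative along \<open>F k\<close> of the tensor \<open>(\<partial>f\<^sub>u)\<^sup>T J (\<partial>f\<^sub>v)\<close>; on the left
  the Leibniz rule has distributed it over the two factors.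
\<close>

lemma pullback_Cons:
  assumes F: "\<And>k. smooth (F k)"
  shows "pullback J F (k # u) v a b x + pullback J F u (k # v) a b x =
    along (F k) (pullback J F u v a b) x
    + (\<Sum>c\<in>UNIV. pd a (\<lambda>x. F k x $ c) x * pullback J F u v c b x)
    + (\<Sum>c\<in>UNIV. pd b (\<lambda>x. F k x $ c) x * pullback J F u v a c x)"
proof -
  define f where "f w i = (\<lambda>x. word_fun F w x $ i)" for w i
  have sm: "smooth (f w i)" for w i unfolding f_def by (intro smooth_component smooth_word_fun F)
  have Cons: "pd a (f (k # w) i) x = along (F k) (pd a (f w i)) x + (\<Sum>c\<in>UNIV. pd a (\<lambda>x. F k x $ c) x * pd c (f w i) x)" for w i a
    using pd_along[OF F sm] by (simp add: f_def word_fun_Cons[OF F])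
  have p: "pullback J F u v a b = (\<lambda>x. \<Sum>i\<in>UNIV. \<Sum>j\<in>UNIV. J $ i $ j * (pd a (f u i) x * pd b (f v j) x))" for u v a b
    by (auto simp: pullback_def f_def)
  have D: "along (F k) (pullback J F u v a b) x = (\<Sum>i\<in>UNIV. \<Sum>j\<in>UNIV. J $ i $ j *
      (pd a (f u i) x * along (F k) (pd b (f v j)) x + along (F k) (pd a (f u i)) x * pd b (f v j) x))"
    unfolding p by (simp add: along_sum along_cmult along_mult smooth_sum smooth_mult smooth_pd sm)
  have E1: "(\<Sum>c\<in>UNIV. pd a (\<lambda>x. F k x $ c) x * pullback J F u v c b x) = (\<Sum>i\<in>UNIV. \<Sum>j\<in>UNIV. J $ i $ j *
      ((\<Sum>c\<in>UNIV. pd a (\<lambda>x. F k x $ c) x * pd c (f u i) x) * pd b (f v j) x))"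
    unfolding p sum_distrib_left sum_distrib_right
    by (subst sum_swap3) (simp add: mult_ac)
  have E2: "(\<Sum>c\<in>UNIV. pd b (\<lambda>x. F k x $ c) x * pullback J F u v a c x) = (\<Sum>i\<in>UNIV. \<Sum>j\<in>UNIV. J $ i $ j *
      (pd a (f u i) x * (\<Sum>c\<in>UNIV. pd b (\<lambda>x. F k x $ c) x * pd c (f v j) x)))"
    unfolding p sum_distrib_left sum_distrib_right
    by (subst sum_swap3) (simp add: mult_ac)
  show ?thesis
    unfolding D E1 E2 unfolding p Cons sum.distrib[symmetric]
    by (intro sum.cong refl) (simp add: algebra_simps)
qed

lemma smooth_pullback_list:
  assumes "\<And>k. smooth (F k)"
  shows "smooth (\<lambda>x. \<Sum>(u, v)\<leftarrow>L. pullback J F u v a b x)"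
  by (induction L) (auto simp: split_beta intro!: smooth_add smooth_pullback assms)

lemma pullback_word_Cons:
  assumes F: "\<And>k. smooth (F k)"
  shows "pullback_word J F (k # w) a b x =
    along (F k) (pullback_word J F w a b) x
    + (\<Sum>c\<in>UNIV. pd a (\<lambda>x. F k x $ c) x * pullback_word J F w c b x)
    + (\<Sum>c\<in>UNIV. pd b (\<lambda>x. F k x $ c) x * pullback_word J F w a c x)"
proof -
  have "(\<Sum>(u, v)\<leftarrow>map (\<lambda>(u, v). (k # u, v)) L @ map (\<lambda>(u, v). (u, k # v)) L. pullback J F u v a b x) =
    along (F k) (\<lambda>x. \<Sum>(u, v)\<leftarrow>L. pullback J F u v a b x) x
    + (\<Sum>c\<in>UNIV. pd a (\<lambda>x. F k x $ c) x * (\<Sum>(u, v)\<leftarrow>L. pullback J F u v c b x))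
    + (\<Sum>c\<in>UNIV. pd b (\<lambda>x. F k x $ c) x * (\<Sum>(u, v)\<leftarrow>L. pullback J F u v a c x))" for L
  proof (induction L)
    case (Cons p L)
    obtain u v where p: "p = (u, v)" by fastforce
    have "along (F k) (\<lambda>x. pullback J F u v a b x + (\<Sum>(u, v)\<leftarrow>L. pullback J F u v a b x)) x =
       along (F k) (pullback J F u v a b) x + along (F k) (\<lambda>x. (\<Sum>(u, v)\<leftarrow>L. pullback J F u v a b x)) x"
      by (intro along_add smooth_pullback smooth_pullback_list F)
    then show ?case using Cons pullback_Cons[where F = F and J = J and k = k and u = u and v = v and a = a and b = b and x = x, OF F]
      by (simp add: p sum.distrib algebra_simps)
  qed simp
  then show ?thesis by (simp add: pullback_word_def[abs_def])
qed

lemma pullback_Nil_right: "pullback J F u [] a b x = (\<Sum>i\<in>UNIV. pd a (\<lambda>x. word_fun F u x $ i) x * J $ i $ b)"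
  by (simp add: pullback_def cvec_def pd_coordinate if_distrib[of "\<lambda>z. _ * z"] cong: if_cong)
    (simp add: mult.commute)

lemma pullback_Nil_left: "pullback J F [] v a b x = (\<Sum>j\<in>UNIV. J $ a $ j * pd b (\<lambda>x. word_fun F v x $ j) x)"
  unfolding pullback_def by (subst sum.swap) (simp add: cvec_def pd_coordinate if_distrib[of "\<lambda>z. z * _"] if_distrib[of "\<lambda>z. _ * z"] cong: if_cong)

lemma pullback_word_Nil: "pullback_word J F [] a b x = J $ a $ b"
  by (simp add: pullback_word_def pullback_Nil_left cvec_def pd_coordinate if_distrib[of "\<lambda>z. _ * z"] cong: if_cong)

text \<open>
  The assumption \<open>inv\<close> says that the Lie derivative of \<open>J\<close> along each \<open>F k\<close> vanishes.  Hence the last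
  letter of \<open>w\<close> already gives the zero tensor.
\<close>

lemma pullback_word_eq_0:
  assumes F: "\<And>k. smooth (F k)"
    and inv: "\<And>k a b x. (\<Sum>c\<in>UNIV. pd a (\<lambda>x. F k x $ c) x * J $ c $ b) + (\<Sum>c\<in>UNIV. pd b (\<lambda>x. F k x $ c) x * J $ a $ c) = 0"
    and "w \<noteq> []"
  shows "pullback_word J F w a b x = 0"
  using assms(3)
proof (induction w arbitrary: a b x)
  case (Cons k w)
  show ?case
  proof (cases "w = []")
    case True
    then show ?thesis
      using inv[of a k x b] by (simp add: pullback_word_Cons[OF F] pullback_word_Nil[abs_def])
  next
    case False
    then have "pullback_word J F w = (\<lambda>a b x. 0)" using Cons.IH by blast
    then show ?thesis by (simp add: pullback_word_Cons[OF F])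
  qed
qed simp

section \<open>The Poincare lemma\<close>

lemma derivative_eq_sum_pd:
  fixes g :: "real ^ 'n::finite \<Rightarrow> complex"
  assumes "smooth g"
  shows "frechet_derivative g (at x) v = (\<Sum>c\<in>UNIV. of_real (v $ c) * pd c g x)"
proof -
  have lin: "linear (frechet_derivative g (at x))"
    using smooth_has_derivative[OF assms] by (rule has_derivative_linear)
  have "frechet_derivative g (at x) v = frechet_derivative g (at x) (\<Sum>c\<in>UNIV. v $ c *\<^sub>R axis c 1)"
    using basis_expansion[of v] by (simp add: scalar_mult_eq_scaleR)
  also have "\<dots> = (\<Sum>c\<in>UNIV. of_real (v $ c) * pd c g x)"
    by (simp add: linear_sum[OF lin] linear_cmul[OF lin] pd_def scaleR_conv_of_real[where 'a = complex])
  finally show ?thesis .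
qed

text \<open>
  The potential is the integral of the 1-form along the segment from the origin to \<open>x\<close>.  By
  closedness the derivative of its integrand in direction \<open>v\<close> is the \<open>t\<close>-derivative of
  \<open>t * (\<Sum>b. v\<^sub>b * g b (t x))\<close>.
\<close>

lemma poincare_lemma:
  fixes g :: "'n::finite \<Rightarrow> real ^ 'n \<Rightarrow> complex"
  assumes sm: "\<And>a. smooth (g a)" and closed: "\<And>a b x. pd a (g b) x = pd b (g a) x"
  obtains H where "smooth H" "\<And>a x. pd a H x = g a x"
proof -
  define D where "D b y v = frechet_derivative (g b) (at y) v" for b y v
  have deriv: "(g b has_derivative D b y) (at y)" for b y
    using smooth_has_derivative[OF sm] by (simp add: D_def[abs_def])
  have smD: "smooth (\<lambda>y. D b y v)" for b v unfolding D_def by (rule smooth_derivative[OF sm])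
  have cont: "continuous_on S h" if "smooth h" for h :: "real ^ 'n \<Rightarrow> complex" and S using smooth_continuous[OF that] .
  have lin: "linear (D b y)" for b y using deriv by (rule has_derivative_linear)
  \<comment> \<open>closedness: the derivative of the field is a symmetric bilinear form\<close>
  have swap: "(\<Sum>b\<in>UNIV. of_real (x $ b) * D b y v) = (\<Sum>b\<in>UNIV. of_real (v $ b) * D b y x)" for x y v
    unfolding D_def derivative_eq_sum_pd[OF sm] sum_distrib_left
    by (subst sum.swap) (simp add: closed mult_ac)
  define f where "f x t = (\<Sum>b\<in>UNIV. complex_of_real (x $ b) * g b (t *\<^sub>R x))" for x t
  define f' where "f' x t v = (\<Sum>b\<in>UNIV. complex_of_real (x $ b) * D b (t *\<^sub>R x) (t *\<^sub>R v) + complex_of_real (v $ b) * g b (t *\<^sub>R x))" for x t v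
  define H where "H x = integral (cbox 0 1) (f x)" for x
  have f: "((\<lambda>x. f x t) has_derivative f' x t) (at x)" for x t
    unfolding f_def f'_def
    by (intro has_derivative_sum has_derivative_mult has_derivative_coordinate
        has_derivative_compose[OF _ deriv] has_derivative_scaleR_right has_derivative_ident)
  have bl: "bounded_linear (f' x t)" for x t using f by (rule has_derivative_bounded_linear)
  have "((\<lambda>x. H x) has_derivative blinfun_apply (integral (cbox 0 1) (\<lambda>t. Blinfun (f' x t)))) (at x within UNIV)" for x
    unfolding H_def
  proof (rule leibniz_rule)
    show "((\<lambda>x. f x t) has_derivative blinfun_apply (Blinfun (f' x t))) (at x within UNIV)" for x t
      using f bl by (simp add: bounded_linear_Blinfun_apply)
    show "f x integrable_on cbox 0 1" for x
      unfolding f_def by (intro integrable_continuous continuous_intros continuous_on_compose2[OF cont[OF sm, of UNIV]]) auto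
    show "continuous_on (UNIV \<times> cbox 0 1) (\<lambda>(x, t). Blinfun (f' x t))"
    proof (rule continuous_on_blinfun_componentwise)
      fix i :: "real ^ 'n"
      have eq: "blinfun_apply ((\<lambda>(x, t). Blinfun (f' x t)) z) i = (\<Sum>b\<in>UNIV. complex_of_real (fst z $ b) * (of_real (snd z) * D b (snd z *\<^sub>R fst z) i)
          + complex_of_real (i $ b) * g b (snd z *\<^sub>R fst z))" for z
        using bl by (simp add: split_beta bounded_linear_Blinfun_apply f'_def linear_cmul[OF lin] scaleR_conv_of_real[where 'a = complex])
      show "continuous_on (UNIV \<times> cbox 0 1) (\<lambda>z. blinfun_apply ((\<lambda>(x, t). Blinfun (f' x t)) z) i)"
        unfolding eq
        by (intro continuous_intros continuous_on_compose2[OF cont[OF sm, of UNIV]] continuous_on_compose2[OF cont[OF smD, of UNIV]]) auto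
    qed
  qed auto
  moreover have potential_derivative: "blinfun_apply (integral (cbox 0 1) (\<lambda>t. Blinfun (f' x t))) v = (\<Sum>b\<in>UNIV. complex_of_real (v $ b) * g b x)" for x v
  proof -
    have ray: "((\<lambda>t. g b (t *\<^sub>R x)) has_vector_derivative D b (t *\<^sub>R x) x) (at t within S)" for b t S
    proof -
      have "((\<lambda>t. t *\<^sub>R x) has_vector_derivative x) (at t within S)"
        by (auto intro!: derivative_eq_intros)
      from vector_derivative_diff_chain_within[OF this, of "g b" "D b (t *\<^sub>R x)"] show ?thesis
        using deriv by (auto simp: o_def intro: has_derivative_at_withinI)
    qed
    have "((\<lambda>t. t *\<^sub>R (\<Sum>b\<in>UNIV. complex_of_real (v $ b) * g b (t *\<^sub>R x))) has_vector_derivative f' x t v) (at t within {0..1})" for t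
    proof -
      have "((\<lambda>t. t *\<^sub>R (\<Sum>b\<in>UNIV. complex_of_real (v $ b) * g b (t *\<^sub>R x))) has_vector_derivative
         t *\<^sub>R (\<Sum>b\<in>UNIV. complex_of_real (v $ b) * D b (t *\<^sub>R x) x) + 1 *\<^sub>R (\<Sum>b\<in>UNIV. complex_of_real (v $ b) * g b (t *\<^sub>R x))) (at t within {0..1})"
        by (intro has_vector_derivative_scaleR has_vector_derivative_sum has_vector_derivative_mult_right ray DERIV_ident)
      moreover have "f' x t v = t *\<^sub>R (\<Sum>b\<in>UNIV. complex_of_real (x $ b) * D b (t *\<^sub>R x) v) + (\<Sum>b\<in>UNIV. complex_of_real (v $ b) * g b (t *\<^sub>R x))"
        by (simp add: f'_def linear_cmul[OF lin] sum.distrib scaleR_sum_right)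
      ultimately show ?thesis by (simp add: swap)
    qed
    then have "((\<lambda>t. f' x t v) has_integral 1 *\<^sub>R (\<Sum>b\<in>UNIV. complex_of_real (v $ b) * g b (1 *\<^sub>R x))
       - 0 *\<^sub>R (\<Sum>b\<in>UNIV. complex_of_real (v $ b) * g b (0 *\<^sub>R x))) {0..1}"
      by (intro fundamental_theorem_of_calculus) auto
    then have "((\<lambda>t. f' x t v) has_integral (\<Sum>b\<in>UNIV. complex_of_real (v $ b) * g b x)) {0..1}" by simp
    moreover have "(\<lambda>t. Blinfun (f' x t)) integrable_on cbox 0 1"
    proof (intro integrable_continuous continuous_on_blinfun_componentwise)
      fix i :: "real ^ 'n"
      show "continuous_on (cbox 0 1) (\<lambda>t. blinfun_apply (Blinfun (f' x t)) i)"
        unfolding bounded_linear_Blinfun_apply[OF bl] f'_def linear_cmul[OF lin]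
        by (intro continuous_intros continuous_on_compose2[OF cont[OF sm, of UNIV]] continuous_on_compose2[OF cont[OF smD, of UNIV]]) auto
    qed
    ultimately show ?thesis
      by (simp add: blinfun_apply_integral bounded_linear_Blinfun_apply[OF bl] integral_unique)
  qed
  ultimately have H: "(H has_derivative (\<lambda>v. \<Sum>b\<in>UNIV. complex_of_real (v $ b) * g b x)) (at x)" for x
    by (simp only: potential_derivative[symmetric])
  show thesis
  proof
    show "smooth H" using H by (rule smoothI) (intro smooth_sum smooth_mult smooth_const sm)
    show "pd a H x = g a x" for a x
      by (subst has_derivative_imp_pd[OF H]) (simp add: axis_def if_distrib[of complex_of_real] if_distrib[of "\<lambda>z. z * _"] cong: if_cong)
  qed
qed

section \<open>Summation over the splittings of a multiset of letters\<close>

lemma sum_list_count: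
  fixes f :: "'a \<Rightarrow> complex"
  assumes "finite S" "set xs \<subseteq> S"
  shows "(\<Sum>x\<leftarrow>xs. f x) = (\<Sum>x\<in>S. of_nat (count (mset xs) x) * f x)"
  using assms(2)
proof (induction xs)
  case (Cons y xs)
  have "(\<Sum>x\<in>S. of_nat (count (mset (y # xs)) x) * f x) = (\<Sum>x\<in>S. of_nat (count (mset xs) x) * f x + (if x = y then f x else 0))"
    by (intro sum.cong) (auto simp: algebra_simps)
  also have "\<dots> = (\<Sum>x\<in>S. of_nat (count (mset xs) x) * f x) + f y"
    using Cons.prems assms(1) by (simp add: sum.distrib)
  finally show ?case using Cons by simp
qed simp

lemma count_Cons_shuffle: "count (image_mset ((#) x) M) (k # w) = (if x = k then count M w else 0)"
  by (induction M) auto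

text \<open>
  Both counts obey the same recursion, because the first letter of \<open>w\<close> comes either from \<open>u\<close> or
  from \<open>v\<close>.
\<close>

lemma count_unshuffle:
  "count (mset (unshuffle w)) (u, v) = count (mset (shuffle u v)) w"
proof (induction w arbitrary: u v)
  case Nil
  show ?case by (cases u; cases v) (auto simp: count_eq_zero_iff)
next
  case (Cons k w)
  have 1: "count (image_mset (\<lambda>(u, v). (k # u, v)) M) (u, v) = (case u of [] \<Rightarrow> 0 | x # u' \<Rightarrow> if x = k then count M (u', v) else 0)"
    for M :: "('a list \<times> 'a list) multiset" and u v
    by (induction M) (auto split: list.splits)
  have 2: "count (image_mset (\<lambda>(u, v). (u, k # v)) M) (u, v) = (case v of [] \<Rightarrow> 0 | x # v' \<Rightarrow> if x = k then count M (u, v') else 0)"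
    for M :: "('a list \<times> 'a list) multiset" and u v
    by (induction M) (auto split: list.splits)
  show ?case
    by (cases u; cases v) (auto simp: 1 2 Cons count_Cons_shuffle)
qed

lemma finite_words_mset: "finite {w. mset w = M}"
  by (rule finite_subset[OF _ finite_lists_length_eq[OF finite_set_mset, of M "size M"]]) auto

lemma finite_submultisets: "finite {N. N \<subseteq># M}"
proof (rule finite_subset)
  show "{N. N \<subseteq># M} \<subseteq> mset ` {w. set w \<subseteq> set_mset M \<and> length w \<le> size M}"
  proof
    fix N assume "N \<in> {N. N \<subseteq># M}"
    moreover obtain w where "N = mset w" by (metis ex_mset)
    ultimately have "set w \<subseteq> set_mset M \<and> length w \<le> size M"
      using set_mset_mono[of N M] size_mset_mono[of N M] by simp
    with \<open>N = mset w\<close> show "N \<in> mset ` {w. set w \<subseteq> set_mset M \<and> length w \<le> size M}" by blast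
  qed
  show "finite (mset ` {w. set w \<subseteq> set_mset M \<and> length w \<le> size M})"
    by (intro finite_imageI finite_lists_length_le) simp
qed

lemma words_pairs_eq: "{(u, v). mset u + mset v = M} = (SIGMA u : (\<Union>N\<in>{N. N \<subseteq># M}. {u. mset u = N}). {v. mset v = M - mset u})"
  by auto

lemma finite_word_pairs: "finite {(u, v). mset u + mset v = M}"
  unfolding words_pairs_eq by (intro finite_SigmaI finite_UN_I finite_submultisets finite_words_mset)

lemma sum_word_pairs:
  "(\<Sum>(u, v) | mset u + mset v = M. g u v) = (\<Sum>N | N \<subseteq># M. \<Sum>u | mset u = N. \<Sum>v | mset v = M - N. g u v)"
proof -
  have "(\<Sum>N | N \<subseteq># M. sum (\<lambda>(u, v). g u v) {p. p \<in> {(u, v). mset u + mset v = M} \<and> mset (fst p) = N})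
     = (\<Sum>(u, v) | mset u + mset v = M. g u v)"
    by (rule sum.group[OF finite_word_pairs finite_submultisets]) auto
  moreover have "sum (\<lambda>(u, v). g u v) {p. p \<in> {(u, v). mset u + mset v = M} \<and> mset (fst p) = N}
     = (\<Sum>u | mset u = N. \<Sum>v | mset v = M - N. g u v)" if "N \<subseteq># M" for N
  proof -
    have "{p. p \<in> {(u, v). mset u + mset v = M} \<and> mset (fst p) = N} = {u. mset u = N} \<times> {v. mset v = M - N}"
      using that by auto
    then show ?thesis by (simp add: sum.cartesian_product)
  qed
  ultimately show ?thesis by (metis (no_types, lifting) mem_Collect_eq sum.cong)
qed

text \<open>
  Exchanging the two summations replaces a sum over splittings of words by a sum over pairs of words,
  in which the coefficient appears through its shuffle relations.
\<close>

lemma sum_unshuffle: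
  "(\<Sum>w | mset w = M. c w * (\<Sum>(u, v)\<leftarrow>unshuffle w. g u v)) = (\<Sum>(u, v) | mset u + mset v = M. copr c u v * g u v)"
proof -
  let ?P = "{(u, v). mset u + mset v = M}" and ?W = "{w. mset w = M}"
  have mem: "(u, v) \<in> set (unshuffle w) \<longleftrightarrow> w \<in> shuffles u v" for u v w
    using count_unshuffle[of w u v] by (metis count_eq_zero_iff set_mset_mset set_shuffle)
  have "(\<Sum>w\<in>?W. c w * (\<Sum>(u, v)\<leftarrow>unshuffle w. g u v))
      = (\<Sum>w\<in>?W. c w * (\<Sum>p\<in>?P. of_nat (count (mset (unshuffle w)) p) * (case p of (u, v) \<Rightarrow> g u v)))"
    by (intro sum.cong refl arg_cong2[where f = times] sum_list_count finite_word_pairs)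
       (auto simp: mem mset_shuffles)
  also have "\<dots> = (\<Sum>p\<in>?P. \<Sum>w\<in>?W. c w * (of_nat (count (mset (unshuffle w)) p) * (case p of (u, v) \<Rightarrow> g u v)))"
    unfolding sum_distrib_left by (rule sum.swap)
  also have "\<dots> = (\<Sum>p\<in>?P. case p of (u, v) \<Rightarrow> copr c u v * g u v)"
  proof (intro sum.cong refl)
    fix p assume "p \<in> ?P"
    then obtain u v where p: "p = (u, v)" "mset u + mset v = M" by auto
    have "copr c u v = (\<Sum>w\<in>?W. of_nat (count (mset (shuffle u v)) w) * c w)"
      unfolding copr_def by (intro sum_list_count finite_words_mset) (use p in \<open>auto simp: set_shuffle mset_shuffles\<close>)
    then have "copr c u v * g u v = (\<Sum>w\<in>?W. c w * (of_nat (count (mset (unshuffle w)) (u, v)) * g u v))"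
      by (simp only: count_unshuffle sum_distrib_right) (simp add: mult_ac)
    then show "(\<Sum>w\<in>?W. c w * (of_nat (count (mset (unshuffle w)) p) * (case p of (u, v) \<Rightarrow> g u v)))
        = (case p of (u, v) \<Rightarrow> copr c u v * g u v)"
      using p(1) by simp
  qed
  finally show ?thesis .
qed

section \<open>Symplectic changes of variables and Hamiltonian fields\<close>

text \<open>
  The Lie derivative of the constant tensor \<open>J\<close> along \<open>V\<close> vanishes.
\<close>

definition invariant_form :: "complex ^ ('n::finite) ^ 'n \<Rightarrow> (real ^ 'n \<Rightarrow> complex ^ 'n) \<Rightarrow> bool" where
  "invariant_form J V \<longleftrightarrow> (\<forall>a b x. (\<Sum>c\<in>UNIV. pd a (\<lambda>x. V x $ c) x * J $ c $ b) + (\<Sum>c\<in>UNIV. pd b (\<lambda>x. V x $ c) x * J $ a $ c) = 0)"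

lemma word_series_component:
  "word_series F \<delta> M x $ i = (\<Sum>w | mset w = M. \<delta> w * word_fun F w x $ i)"
  by (simp add: word_series_def)

lemma smooth_word_series:
  assumes "\<And>k. smooth (F k)" shows "smooth (word_series F \<delta> M)"
  by (rule smooth_vec)
     (unfold word_series_component, intro smooth_sum smooth_mult smooth_const smooth_component smooth_word_fun assms)

lemma pd_word_series:
  assumes "\<And>k. smooth (F k)"
  shows "pd a (\<lambda>x. word_series F \<delta> M x $ i) x = (\<Sum>w | mset w = M. \<delta> w * pd a (\<lambda>x. word_fun F w x $ i) x)"
  unfolding word_series_component
  by (simp add: pd_sum pd_cmult smooth_mult smooth_component smooth_word_fun assms)

lemma sum_swap4:
  "(\<Sum>u\<in>U. \<Sum>v\<in>V. \<Sum>i\<in>A. \<Sum>j\<in>B. h u v i j) = (\<Sum>i\<in>A. \<Sum>j\<in>B. \<Sum>u\<in>U. \<Sum>v\<in>V. h u v i j)"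
proof -
  have "(\<Sum>u\<in>U. \<Sum>v\<in>V. \<Sum>i\<in>A. \<Sum>j\<in>B. h u v i j) = (\<Sum>u\<in>U. \<Sum>i\<in>A. \<Sum>j\<in>B. \<Sum>v\<in>V. h u v i j)"
    by (intro sum.cong refl sum_swap3)
  also have "\<dots> = (\<Sum>i\<in>A. \<Sum>j\<in>B. \<Sum>u\<in>U. \<Sum>v\<in>V. h u v i j)"
    by (rule sum_swap3)
  finally show ?thesis .
qed

lemma symplectic_product_entry:
  assumes F: "\<And>k. smooth (F k)"
  shows "(transpose (jacobian (word_series F \<kappa> N) x) ** J ** jacobian (word_series F \<kappa> M) x) $ a $ b
     = (\<Sum>u | mset u = N. \<Sum>v | mset v = M. \<kappa> u * \<kappa> v * pullback J F u v a b x)"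
proof -
  let ?f = "\<lambda>a w i. pd a (\<lambda>x. word_fun F w x $ i) x"
  have "(transpose (jacobian (word_series F \<kappa> N) x) ** J ** jacobian (word_series F \<kappa> M) x) $ a $ b
     = (\<Sum>j\<in>UNIV. \<Sum>i\<in>UNIV. (\<Sum>u | mset u = N. \<kappa> u * ?f a u i) * J $ i $ j * (\<Sum>v | mset v = M. \<kappa> v * ?f b v j))"
    by (simp add: matrix_matrix_mult_def transpose_def jacobian_component smooth_word_series F pd_word_series sum_distrib_right)
  also have "\<dots> = (\<Sum>i\<in>UNIV. \<Sum>j\<in>UNIV. \<Sum>u | mset u = N. \<Sum>v | mset v = M. \<kappa> u * \<kappa> v * (J $ i $ j * (?f a u i * ?f b v j)))"
    by (subst sum.swap) (simp add: sum_distrib_left sum_distrib_right mult_ac)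
  also have "\<dots> = (\<Sum>u | mset u = N. \<Sum>v | mset v = M. \<Sum>i\<in>UNIV. \<Sum>j\<in>UNIV. \<kappa> u * \<kappa> v * (J $ i $ j * (?f a u i * ?f b v j)))"
    by (rule sum_swap4[symmetric])
  finally show ?thesis by (simp add: pullback_def sum_distrib_left)
qed

text \<open>
  For a group element the products \<open>\<kappa>\<^sub>u \<kappa>\<^sub>v\<close> are values of \<open>copr \<kappa>\<close>, so the Cauchy product is the sum
  of \<open>\<kappa>\<^sub>w\<close> times the iterated Lie derivative of \<open>J\<close> along \<open>w\<close>, of which only the empty word survives.
\<close>

lemma word_series_symplectic:
  assumes F: "\<And>k. smooth (F k)" and J: "\<And>k. invariant_form J (F k)" and \<kappa>: "\<kappa> \<in> grp"
  shows "formal_symplectic J (word_series F \<kappa>)"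
  unfolding formal_symplectic_def
proof (intro conjI allI)
  show "smooth (word_series F \<kappa> M)" for M using F by (rule smooth_word_series)
  fix M x
  show "(\<Sum>N | N \<subseteq># M. transpose (jacobian (word_series F \<kappa> N) x) ** J ** jacobian (word_series F \<kappa> (M - N)) x) = (if M = {#} then J else 0)"
    (is "?L = ?R")
  proof -
    have "?L $ a $ b = ?R $ a $ b" for a b
    proof -
      have "?L $ a $ b = (\<Sum>N | N \<subseteq># M. \<Sum>u | mset u = N. \<Sum>v | mset v = M - N. \<kappa> u * \<kappa> v * pullback J F u v a b x)"
        by (simp add: symplectic_product_entry F)
      also have "\<dots> = (\<Sum>(u, v) | mset u + mset v = M. copr \<kappa> u v * pullback J F u v a b x)"
        using \<kappa> by (simp add: sum_word_pairs grp_iff tens_def)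
      also have "\<dots> = (\<Sum>w | mset w = M. \<kappa> w * pullback_word J F w a b x)"
        by (simp add: sum_unshuffle[symmetric] pullback_word_def)
      also have "\<dots> = (\<Sum>w | mset w = M. if w = [] then J $ a $ b else 0)"
        using J \<kappa> by (intro sum.cong refl) (auto simp: pullback_word_Nil grp_iff invariant_form_def pullback_word_eq_0[OF F])
      also have "\<dots> = ?R $ a $ b"
        by (cases "M = {#}") (auto intro!: sum.neutral)
      finally show ?thesis .
    qed
    then show ?thesis by (simp add: vec_eq_iff)
  qed
qed

text \<open>
  The sum of \<open>\<beta>\<^sub>w\<close> times the iterated Lie derivative of \<open>J\<close> along \<open>w\<close> is zero.  For a Lie element
  only the splittings \<open>(u, [])\<close> and \<open>([], v)\<close> contribute to it, and these are the two summands of the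
  Lie derivative of \<open>J\<close> along the word series.
\<close>

lemma lie_word_series_invariant_form:
  fixes F :: "int ^ 'd::finite \<Rightarrow> real ^ 'n::finite \<Rightarrow> complex ^ 'n"
  assumes F: "\<And>k. smooth (F k)" and J: "\<And>k. invariant_form J (F k)" and \<beta>: "\<beta> \<in> lie"
  shows "invariant_form J (word_series F \<beta> M)"
proof (cases "M = {#}")
  case True
  then have "word_series F \<beta> M = (\<lambda>x. 0)" using lie_Nil[OF \<beta>] by (auto simp: word_series_def)
  then show ?thesis by (simp add: invariant_form_def)
next
  case False
  show ?thesis unfolding invariant_form_def
  proof (intro allI)
    fix a b x
    let ?P = "{(u, v). mset u + mset v = M}"
    have "0 = (\<Sum>w | mset w = M. \<beta> w * pullback_word J F w a b x)"
      using J False by (intro sum.neutral[symmetric]) (auto simp: invariant_form_def pullback_word_eq_0[OF F])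
    also have "\<dots> = (\<Sum>(u, v)\<in>?P. copr \<beta> u v * pullback J F u v a b x)"
      by (simp add: sum_unshuffle[symmetric] pullback_word_def)
    also have "\<dots> = (\<Sum>(u, v)\<in>?P. if v = [] then \<beta> u * pullback J F u [] a b x else 0)
        + (\<Sum>(u, v)\<in>?P. if u = [] then \<beta> v * pullback J F [] v a b x else 0)"
      unfolding sum.distrib[symmetric] using \<beta>
      by (intro sum.cong refl) (auto simp: lie_iff tens_def unit_coeff_def algebra_simps)
    also have "(\<Sum>(u, v)\<in>?P. if v = [] then \<beta> u * pullback J F u [] a b x else 0) = (\<Sum>u | mset u = M. \<beta> u * pullback J F u [] a b x)"
    proof -
      have "(\<Sum>(u, v)\<in>?P. if v = [] then \<beta> u * pullback J F u [] a b x else 0)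
        = (\<Sum>(u, v)\<in>(\<lambda>u. (u, [] :: (int ^ 'd) list)) ` {u. mset u = M}. if v = [] then \<beta> u * pullback J F u [] a b x else 0)"
        by (intro sum.mono_neutral_right finite_word_pairs) auto
      then show ?thesis by (simp add: sum.reindex inj_on_def)
    qed
    also have "(\<Sum>(u, v)\<in>?P. if u = [] then \<beta> v * pullback J F [] v a b x else 0) = (\<Sum>v | mset v = M. \<beta> v * pullback J F [] v a b x)"
    proof -
      have "(\<Sum>(u, v)\<in>?P. if u = [] then \<beta> v * pullback J F [] v a b x else 0)
        = (\<Sum>(u, v)\<in>(\<lambda>v. ([] :: (int ^ 'd) list, v)) ` {v. mset v = M}. if u = [] then \<beta> v * pullback J F [] v a b x else 0)"
        by (intro sum.mono_neutral_right finite_word_pairs) auto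
      then show ?thesis by (simp add: sum.reindex inj_on_def)
    qed
    also have "(\<Sum>u | mset u = M. \<beta> u * pullback J F u [] a b x) = (\<Sum>c\<in>UNIV. pd a (\<lambda>x. word_series F \<beta> M x $ c) x * J $ c $ b)"
      unfolding pd_word_series[OF F] pullback_Nil_right sum_distrib_left sum_distrib_right
      by (subst sum.swap) (simp add: mult_ac)
    also have "(\<Sum>v | mset v = M. \<beta> v * pullback J F [] v a b x) = (\<Sum>c\<in>UNIV. pd b (\<lambda>x. word_series F \<beta> M x $ c) x * J $ a $ c)"
      unfolding pd_word_series[OF F] pullback_Nil_left sum_distrib_left sum_distrib_right
      by (subst sum.swap) (simp add: mult_ac)
    finally show "(\<Sum>c\<in>UNIV. pd a (\<lambda>x. word_series F \<beta> M x $ c) x * J $ c $ b) + (\<Sum>c\<in>UNIV. pd b (\<lambda>x. word_series F \<beta> M x $ c) x * J $ a $ c) = 0"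
      by simp
  qed
qed

lemma gradient_component: "gradient H x $ a = pd a H x"
  by (simp add: gradient_def pd_def)

locale symplectic_form =
  fixes J :: "complex ^ ('n::finite) ^ 'n"
  assumes skew: "\<And>i j. J $ i $ j = - J $ j $ i" and square: "J ** J = - mat 1"
begin

lemma inverse: "J ** matrix_inv J = mat 1" "matrix_inv J ** J = mat 1"
proof -
  have "(- J) ** J = mat 1" "J ** (- J) = mat 1"
    using square by (simp_all add: vec_eq_iff matrix_matrix_mult_def sum_negf)
  then have "\<exists>K. J ** K = mat 1 \<and> K ** J = mat 1" by blast
  then have "J ** matrix_inv J = mat 1 \<and> matrix_inv J ** J = mat 1"
    unfolding matrix_inv_def by (rule someI_ex)
  then show "J ** matrix_inv J = mat 1" "matrix_inv J ** J = mat 1" by auto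
qed

lemma hamiltonian_field_iff:
  "hamiltonian_field J V \<longleftrightarrow> (\<exists>H. smooth H \<and> (\<forall>a x. pd a H x = (\<Sum>c\<in>UNIV. J $ a $ c * V x $ c)))"
proof -
  have "V x = matrix_inv J *v gradient H x \<longleftrightarrow> (\<forall>a. pd a H x = (\<Sum>c\<in>UNIV. J $ a $ c * V x $ c))" for H x
  proof -
    have "V x = matrix_inv J *v gradient H x \<longleftrightarrow> J *v V x = gradient H x"
      by (metis inverse matrix_vector_mul_assoc matrix_vector_mul_lid)
    then show ?thesis by (auto simp: vec_eq_iff gradient_component matrix_vector_mult_def)
  qed
  then show ?thesis unfolding hamiltonian_field_def by blast
qed

lemma smooth_hamiltonian_field:
  assumes "hamiltonian_field J V" shows "smooth V"
proof -
  obtain H where H: "smooth H" "\<And>x. V x = matrix_inv J *v gradient H x"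
    using assms by (auto simp: hamiltonian_field_def)
  show ?thesis
    by (rule smooth_vec) (simp add: H matrix_vector_mult_def gradient_component, intro smooth_sum smooth_mult smooth_const smooth_pd H)
qed

text \<open>
  By skew symmetry, invariance of \<open>J\<close> is closedness of the 1-form \<open>J V\<close>.
\<close>

lemma invariant_form_iff:
  assumes "smooth V"
  shows "invariant_form J V \<longleftrightarrow> (\<forall>a b x. pd b (\<lambda>x. \<Sum>c\<in>UNIV. J $ a $ c * V x $ c) x = pd a (\<lambda>x. \<Sum>c\<in>UNIV. J $ b $ c * V x $ c) x)"
proof -
  have "pd b (\<lambda>x. \<Sum>c\<in>UNIV. J $ a $ c * V x $ c) x = (\<Sum>c\<in>UNIV. pd b (\<lambda>x. V x $ c) x * J $ a $ c)" for a b x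
    using assms by (simp add: pd_sum pd_cmult smooth_mult smooth_component) (simp add: mult.commute)
  moreover have "(\<Sum>c\<in>UNIV. pd a (\<lambda>x. V x $ c) x * J $ c $ b) = - (\<Sum>c\<in>UNIV. pd a (\<lambda>x. V x $ c) x * J $ b $ c)" for a b x
    by (subst skew) (simp add: sum_negf)
  ultimately show ?thesis unfolding invariant_form_def by (auto simp: add_eq_0_iff)
qed

lemma hamiltonian_imp_invariant_form:
  assumes "hamiltonian_field J V" shows "invariant_form J V"
proof -
  obtain H where H: "smooth H" "\<And>a x. pd a H x = (\<Sum>c\<in>UNIV. J $ a $ c * V x $ c)"
    using assms unfolding hamiltonian_field_iff by blast
  then have "(\<lambda>x. \<Sum>c\<in>UNIV. J $ a $ c * V x $ c) = pd a H" for a by auto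
  then show ?thesis
    by (simp add: invariant_form_iff smooth_hamiltonian_field assms pd_commute[OF H(1)])
qed

lemma invariant_form_imp_hamiltonian:
  assumes "smooth V" "invariant_form J V" shows "hamiltonian_field J V"
proof -
  define g where "g a = (\<lambda>x. \<Sum>c\<in>UNIV. J $ a $ c * V x $ c)" for a
  have "smooth (g a)" for a unfolding g_def by (intro smooth_sum smooth_mult smooth_const smooth_component assms)
  moreover have "pd a (g b) x = pd b (g a) x" for a b x
    using assms invariant_form_iff unfolding g_def by blast
  ultimately obtain H where "smooth H" "\<And>a x. pd a H x = g a x" using poincare_lemma[of g] by blast
  then show ?thesis unfolding hamiltonian_field_iff g_def by blast
qed

end

text \<open>
  Every row of the matrix has exactly one nonzero entry, in the column of the canonically conjugate
  coordinate.
\<close>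

lemma canonical_symplectic_form:
  assumes "canonical_coords m p q a ang"
  shows "symplectic_form (symplectic_matrix m p q a ang)"
proof -
  define conj where "conj i j \<longleftrightarrow> (\<exists>l<m. i = p l \<and> j = q l) \<or> (\<exists>l. i = a l \<and> j = ang l)" for i j
  define J where "J = symplectic_matrix m p q a ang"
  have J: "J $ i $ j = (if conj i j then 1 else if conj j i then - 1 else 0)" for i j
    by (simp only: J_def symplectic_matrix_def conj_def Let_def vec_lambda_beta)
  let ?e = "case_sum (case_sum p q) (case_sum a ang)"
  let ?S = "({..<m} <+> {..<m}) <+> (UNIV <+> UNIV)"
  have inj: "inj_on ?e ?S" and surj: "?e ` ?S = UNIV"
    using assms by (auto simp: canonical_coords_def bij_betw_def)
  have "p l = p l' \<Longrightarrow> l = l'" "q l = q l' \<Longrightarrow> l = l'" "p l \<noteq> q l'" if "l < m" "l' < m" for l l'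
    using that inj_onD[OF inj, of "Inl (Inl l)" "Inl (Inl l')"] inj_onD[OF inj, of "Inl (Inr l)" "Inl (Inr l')"]
      inj_onD[OF inj, of "Inl (Inl l)" "Inl (Inr l')"] by auto
  moreover have "p l \<noteq> a r" "p l \<noteq> ang r" "q l \<noteq> a r" "q l \<noteq> ang r" if "l < m" for l r
    using that inj_onD[OF inj, of "Inl (Inl l)" "Inr (Inl r)"] inj_onD[OF inj, of "Inl (Inl l)" "Inr (Inr r)"]
      inj_onD[OF inj, of "Inl (Inr l)" "Inr (Inl r)"] inj_onD[OF inj, of "Inl (Inr l)" "Inr (Inr r)"] by auto
  moreover have "a r = a r' \<Longrightarrow> r = r'" "ang r = ang r' \<Longrightarrow> r = r'" "a r \<noteq> ang r'" for r r'
    using inj_onD[OF inj, of "Inr (Inl r)" "Inr (Inl r')"] inj_onD[OF inj, of "Inr (Inr r)" "Inr (Inr r')"]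
      inj_onD[OF inj, of "Inr (Inl r)" "Inr (Inr r')"] by auto
  ultimately have uniq: "conj i j \<Longrightarrow> conj i k \<Longrightarrow> j = k" "conj j i \<Longrightarrow> conj k i \<Longrightarrow> j = k"
    "conj i j \<Longrightarrow> \<not> conj k i" for i j k
    unfolding conj_def by metis+
  have total: "\<exists>j. conj i j \<or> conj j i" for i
  proof -
    have "i \<in> ?e ` ?S" using surj by simp
    then have "(\<exists>l<m. i = p l) \<or> (\<exists>l<m. i = q l) \<or> (\<exists>l. i = a l) \<or> (\<exists>l. i = ang l)"
      by (auto split: sum.splits)
    then show ?thesis unfolding conj_def by blast
  qed
  have "J ** J = - mat 1"
  proof -
    have "(J ** J) $ i $ k = (if i = k then - 1 else 0)" for i k
    proof -
      obtain j where j: "conj i j \<or> conj j i" using total by blast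
      have zero: "J $ i $ l = 0" if "l \<noteq> j" for l
        using that j uniq unfolding J by metis
      have "(J ** J) $ i $ k = (\<Sum>l\<in>UNIV. J $ i $ l * J $ l $ k)"
        by (simp add: matrix_matrix_mult_def)
      also have "\<dots> = (\<Sum>l\<in>UNIV. if l = j then J $ i $ j * J $ j $ k else 0)"
        by (intro sum.cong refl) (simp add: zero)
      also have "\<dots> = J $ i $ j * J $ j $ k" by simp
      also have "\<dots> = (if i = k then - 1 else 0)"
      proof (cases "i = k")
        case True
        then show ?thesis using j uniq(3) by (auto simp: J)
      next
        case False
        then have "\<not> conj j k" "\<not> conj k j" using j uniq by metis+
        then show ?thesis using False by (simp add: J)
      qed
      finally show ?thesis .
    qed
    then show ?thesis by (simp add: vec_eq_iff mat_def)
  qed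
  moreover have "J $ i $ j = - J $ j $ i" for i j
    using uniq(3) by (simp add: J)
  ultimately show ?thesis unfolding J_def[symmetric] by unfold_locales
qed

context symplectic_form
begin

text \<open>
  The frequency vector only adds a constant field, which does not change the Lie derivative of a
  constant form.
\<close>

lemma ext_word_series_hamiltonian:
  fixes F :: "int ^ 'd::finite \<Rightarrow> real ^ 'n \<Rightarrow> complex ^ 'n"
  assumes ham: "\<And>k. hamiltonian_field J (F k)" and "\<beta> \<in> lie"
  shows "formal_hamiltonian J (ext_word_series ang F (v, \<beta>))"
  unfolding formal_hamiltonian_def
proof
  fix M :: "(int ^ 'd) multiset"
  have F: "smooth (F k)" for k using ham by (rule smooth_hamiltonian_field)
  let ?c = "if M = {#} then angle_embed ang v else 0"
  have eq: "ext_word_series ang F (v, \<beta>) M = (\<lambda>x. ?c + word_series F \<beta> M x)" by auto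
  have "pd a (\<lambda>x. (?c + word_series F \<beta> M x) $ i) x = pd a (\<lambda>x. word_series F \<beta> M x $ i) x" for a i x
    by (simp add: pd_add smooth_component smooth_word_series F)
  moreover have "invariant_form J (word_series F \<beta> M)"
    using F hamiltonian_imp_invariant_form[OF ham] assms(2) by (rule lie_word_series_invariant_form)
  ultimately have "invariant_form J (ext_word_series ang F (v, \<beta>) M)"
    unfolding eq invariant_form_def by simp
  then show "hamiltonian_field J (ext_word_series ang F (v, \<beta>) M)"
    by (intro invariant_form_imp_hamiltonian) (unfold eq, intro smooth_add smooth_const smooth_word_series F)
qed

end

theorem theorem1:
  fixes ang :: "'d::finite \<Rightarrow> 'n::finite"
    and f :: "real ^ 'n \<Rightarrow> real ^ 'n"
    and fhat :: "int ^ 'd \<Rightarrow> real ^ 'n \<Rightarrow> complex ^ 'n"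
    and \<omega> :: "real ^ 'd"
    and \<beta> :: "'d coeff"
  assumes "inj ang"
    and "fourier_expansion ang f fhat"
    and "\<forall>j. \<omega> $ j > 0"
    and "\<beta> \<in> lie"
  shows "\<exists>\<kappa> \<in> grp. \<exists>\<beta>h \<in> lie.
     (\<forall>w. xi (cvec \<omega>) \<kappa> w + (\<beta>h \<star> \<kappa>) w = (\<kappa> \<star> \<beta>) w) \<and>
     (\<forall>w. word_dot w (cvec \<omega>) \<noteq> 0 \<longrightarrow> \<beta>h w = 0) \<and>
     commuting (cvec \<omega>, \<lambda>_. 0) (0, \<beta>h) \<and>
     (\<exists>\<alpha>. ext_solution (cvec \<omega>) \<beta>h \<alpha>) \<and>
     (\<exists>\<phi>. word_flow \<beta>h \<phi>) \<and>
     (\<forall>\<alpha> \<phi>. ext_solution (cvec \<omega>) \<beta>h \<alpha> \<longrightarrow> word_flow \<beta>h \<phi> \<longrightarrow>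
       (\<forall>t. (t *\<^sub>R cvec \<omega>, \<alpha> t) = ext_subst (0, \<phi> t) (t *\<^sub>R cvec \<omega>, unit_coeff) \<and>
            (t *\<^sub>R cvec \<omega>, \<alpha> t) = ext_subst (t *\<^sub>R cvec \<omega>, unit_coeff) (0, \<phi> t) \<and>
            (t *\<^sub>R cvec \<omega>, \<alpha> t) = (t *\<^sub>R cvec \<omega>, exp_conv t \<beta>h) \<and>
            (t *\<^sub>R cvec \<omega>, \<alpha> t) = (0, exp_conv t \<beta>h) \<^bold>\<star> (t *\<^sub>R cvec \<omega>, unit_coeff) \<and>
            (t *\<^sub>R cvec \<omega>, \<alpha> t) = (t *\<^sub>R cvec \<omega>, unit_coeff) \<^bold>\<star> (0, exp_conv t \<beta>h))) \<and>
     (\<forall>m p q a. canonical_coords m p q a ang \<longrightarrow>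
       (let F = fourier_mode ang fhat; J = symplectic_matrix m p q a ang in
         (\<forall>k. hamiltonian_field J (F k)) \<longrightarrow>
         formal_symplectic J (word_series F \<kappa>) \<and>
         formal_hamiltonian J (ext_word_series ang F (cvec \<omega>, \<beta>h))))"
proof -
  obtain \<kappa> \<beta>h where \<kappa>: "\<kappa> \<in> grp" and \<beta>h: "\<beta>h \<in> lie"
    and conj: "\<And>w. xi (cvec \<omega>) \<kappa> w + (\<beta>h \<star> \<kappa>) w = (\<kappa> \<star> \<beta>) w"
    and res: "\<And>w. word_dot w (cvec \<omega>) \<noteq> 0 \<Longrightarrow> \<beta>h w = 0"
    using normal_form_exists[OF assms(4), of "cvec \<omega>"] by blast
  have resonant: "resonant (cvec \<omega>) \<beta>h" using res by (simp add: resonant_def)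
  have Nil: "\<beta>h [] = 0" using \<beta>h by (rule lie_Nil)
  have flow: "word_flow \<beta>h (\<lambda>t. exp_conv t \<beta>h)" using Nil by (rule word_flow_exp_conv)
  then have sol: "ext_solution (cvec \<omega>) \<beta>h (\<lambda>t. exp_conv t \<beta>h)"
    by (simp add: resonant_solution_iff[OF resonant])
  have identities: "(t *\<^sub>R cvec \<omega>, \<alpha> t) = ext_subst (0, \<phi> t) (t *\<^sub>R cvec \<omega>, unit_coeff) \<and>
            (t *\<^sub>R cvec \<omega>, \<alpha> t) = ext_subst (t *\<^sub>R cvec \<omega>, unit_coeff) (0, \<phi> t) \<and>
            (t *\<^sub>R cvec \<omega>, \<alpha> t) = (t *\<^sub>R cvec \<omega>, exp_conv t \<beta>h) \<and>
            (t *\<^sub>R cvec \<omega>, \<alpha> t) = (0, exp_conv t \<beta>h) \<^bold>\<star> (t *\<^sub>R cvec \<omega>, unit_coeff) \<and>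
            (t *\<^sub>R cvec \<omega>, \<alpha> t) = (t *\<^sub>R cvec \<omega>, unit_coeff) \<^bold>\<star> (0, exp_conv t \<beta>h)"
    if "ext_solution (cvec \<omega>) \<beta>h \<alpha>" "word_flow \<beta>h \<phi>" for \<alpha> \<phi> t
  proof -
    have "\<alpha> t = exp_conv t \<beta>h" "\<phi> t = exp_conv t \<beta>h"
      using word_flow_unique[OF Nil _ flow] that resonant_solution_iff[OF resonant] by blast+
    then show ?thesis by (simp only: ext_subst_def resonant_ext_mult[OF resonant Nil] simp_thms)
  qed
  have hamiltonian: "formal_symplectic J (word_series F \<kappa>) \<and> formal_hamiltonian J (ext_word_series ang F (cvec \<omega>, \<beta>h))"
    if "canonical_coords m p q a ang" "J = symplectic_matrix m p q a ang" "\<forall>k. hamiltonian_field J (F k)"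
    for m p q a J and F :: "int ^ 'd \<Rightarrow> real ^ 'n \<Rightarrow> complex ^ 'n"
  proof -
    interpret symplectic_form J using that(1) unfolding that(2) by (rule canonical_symplectic_form)
    show ?thesis
      using that(3) \<kappa> \<beta>h
      by (auto intro!: word_series_symplectic smooth_hamiltonian_field hamiltonian_imp_invariant_form ext_word_series_hamiltonian)
  qed
  show ?thesis
    unfolding Let_def
    by (intro bexI[OF _ \<kappa>] bexI[OF _ \<beta>h] conjI allI impI conj res resonant_commuting[OF resonant])
       (use sol flow identities hamiltonian in blast)+
qed

end
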